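(* Let $Q_i\in N_{\kappa_i}(\mathcal{H})$, $i=1,2$, be minimally represented by triples $(\mathcal{K}_i,A_i,\Gamma_i)$, let $Q:=Q_1+Q_2\in N_\kappa(\mathcal{H})$ be given by its orthogonal sum representation $(\tilde{\mathcal{K}},\tilde A,\tilde\Gamma)$, and let $$\tilde{\mathcal{K}}=L_1[+](L_0\dot{+}F)[+]L_2,\qquad \bar L=L_1[+]L_0,\qquad L^{[\perp]}=L_0[+]L_2$$ be a decomposition as described in the context. Then $L_1$ (with the inner product inherited from $\tilde{\mathcal{K}}$) is unitarily equivalent to the minimal state space $\mathcal{K}$ of $Q$; in particular the negative index $\tilde\kappa_1$ of $L_1$ equals $\kappa$.
   Context: $N_\kappa(\mathcal{H})$: operator functions $Q:\mathcal{D}(Q)\to\mathcal{L}(\mathcal{H})$, meromorphic in $\mathbb{C}\setminus\mathbb{R}$, with $Q(\bar z)^*=Q(z)$ and whose kernel $\frac{Q(z)-Q(w)^*}{z-\bar w}$ has exactly $\kappa$ negative squares. A triple $(\mathcal{K},A,\Gamma)$ ($\mathcal{K}$ Pontryagin space, $A$ self-adjoint relation, $z_0\in\rho(A)$, $\Gamma:\mathcal{H}\to\mathcal{K}$ bounded) represents $Q$ if $Q(z)=Q(z_0)^*+(z-\bar z_0)\Gamma^+(I+(z-z_0)(A-z)^{-1})\Gamma$; with $\Gamma_z=(I+(z-z_0)(A-z)^{-1})\Gamma$ it is minimal if $\mathcal{K}=\overline{\mathrm{span}}\{\Gamma_zh\}$; the minimal state space of $Q$ is this $\mathcal{K}$ (unique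 up to isomorphism, negative index $\kappa$), equivalently the completion of $L(Q)/(L(Q)\cap L(Q)^{[\perp]})$ where $L(Q)$ is the span of symbols $\varepsilon_zh$ with $[\varepsilon_zh,\varepsilon_wg]=(\frac{Q(z)-Q(\bar w)}{z-\bar w}h,g)$. Orthogonal sum representation of $Q=Q_1+Q_2$: $\tilde{\mathcal{K}}=\mathcal{K}_1[+]\mathcal{K}_2$, $\tilde A=A_1[+]A_2$, $\tilde\Gamma h=(\Gamma_1h,\Gamma_2h)$, $\mathcal{D}(Q)=\mathcal{D}(Q_1)\cap\mathcal{D}(Q_2)$, $\tilde\Gamma_zh=(\Gamma_{1z}h,\Gamma_{2z}h)$. Set $L:=\mathrm{span}\{\tilde\Gamma_zh:z\in\mathcal{D}(Q),h\in\mathcal{H}\}\subseteq\tilde{\mathcal{K}}$, $L^{[\perp]}$ its orthogonal complement in $\tilde{\mathcal{K}}$, $\bar L$ its closure, $L_0:=\bar L\cap L^{[\perp]}$ (finite-dimensional isotropic). Then there are non-degenerate subspaces $L_1,L_2$ and a neutral subspace $F$ skewly linked to $L_0$ with $\bar L=L_1[+]L_0$, $L^{[\perp]}=L_0[+]L_2$, $\tilde{\mathcal{K}}=L_1[+](L_0\dot+F)[+]L_2$. *)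

theory Defs
  imports "HOL-Analysis.Analysis"
begin

class cvec = ab_group_add +
  fixes scaleC :: "complex \<Rightarrow> 'a \<Rightarrow> 'a"
  assumes scaleC_add_right: "scaleC a (x + y) = scaleC a x + scaleC a y"
    and scaleC_add_left: "scaleC (a + b) x = scaleC a x + scaleC b x"
    and scaleC_scaleC: "scaleC a (scaleC b x) = scaleC (a * b) x"
    and scaleC_one: "scaleC 1 x = x"

instantiation prod :: (cvec, cvec) cvec
begin
definition scaleC_prod_def: "scaleC c (p :: 'a \<times> 'b) = (scaleC c (fst p), scaleC c (snd p))"
instance
  by standard (auto simp: scaleC_prod_def scaleC_add_right scaleC_add_left scaleC_scaleC scaleC_one)
end

definition csubspace :: "'a::cvec set \<Rightarrow> bool" where
  "csubspace S \<longleftrightarrow> 0 \<in> S \<and> (\<forall>x\<in>S. \<forall>y\<in>S. x + y \<in> S) \<and> (\<forall>c. \<forall>x\<in>S. scaleC c x \<in> S)"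

definition lincomb :: "complex list \<Rightarrow> 'a::cvec list \<Rightarrow> 'a" where
  "lincomb cs vs = sum_list (map2 scaleC cs vs)"

definition cspan :: "'a::cvec set \<Rightarrow> 'a set" where
  "cspan S = {x. \<exists>cs vs. length cs = length vs \<and> set vs \<subseteq> S \<and> x = lincomb cs vs}"

definition ssum :: "'a::cvec set \<Rightarrow> 'a set \<Rightarrow> 'a set" where
  "ssum A B = {x. \<exists>a\<in>A. \<exists>b\<in>B. x = a + b}"

definition clinear :: "('a::cvec \<Rightarrow> 'b::cvec) \<Rightarrow> bool" where
  "clinear f \<longleftrightarrow> (\<forall>x y. f (x + y) = f x + f y) \<and> (\<forall>c x. f (scaleC c x) = scaleC c (f x))"

definition sesq_herm :: "('a::cvec \<Rightarrow> 'a \<Rightarrow> complex) \<Rightarrow> bool" where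
  "sesq_herm ip \<longleftrightarrow> (\<forall>x y z. ip (x + y) z = ip x z + ip y z)
     \<and> (\<forall>c x y. ip (scaleC c x) y = c * ip x y)
     \<and> (\<forall>x y. ip y x = cnj (ip x y))"

definition ncomplete :: "('a::cvec \<Rightarrow> real) \<Rightarrow> 'a set \<Rightarrow> bool" where
  "ncomplete nrm S \<longleftrightarrow> (\<forall>xs. (\<forall>k. xs k \<in> S) \<and>
      (\<forall>e>0. \<exists>M. \<forall>m\<ge>M. \<forall>n\<ge>M. nrm (xs m - xs n) < e) \<longrightarrow>
      (\<exists>x\<in>S. (\<lambda>k. nrm (xs k - x)) \<longlonglongrightarrow> 0))"

definition hnorm :: "('a::cvec \<Rightarrow> 'a \<Rightarrow> complex) \<Rightarrow> 'a \<Rightarrow> real" where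
  "hnorm hip x = sqrt (Re (hip x x))"

definition hilbert :: "('a::cvec \<Rightarrow> 'a \<Rightarrow> complex) \<Rightarrow> bool" where
  "hilbert hip \<longleftrightarrow> sesq_herm hip \<and> (\<forall>x. x \<noteq> 0 \<longrightarrow> Re (hip x x) > 0)
     \<and> ncomplete (hnorm hip) UNIV"

definition adm_decomp :: "('a::cvec \<Rightarrow> 'a \<Rightarrow> complex) \<Rightarrow> 'a set \<Rightarrow> 'a set \<Rightarrow> bool" where
  "adm_decomp ip P N \<longleftrightarrow> csubspace P \<and> csubspace N \<and> ssum P N = UNIV \<and> P \<inter> N = {0}
     \<and> (\<forall>p\<in>P. \<forall>n\<in>N. ip p n = 0)
     \<and> (\<forall>p\<in>P. p \<noteq> 0 \<longrightarrow> Re (ip p p) > 0)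
     \<and> (\<forall>n\<in>N. n \<noteq> 0 \<longrightarrow> Re (ip n n) < 0)
     \<and> (\<exists>vs. N = cspan (set vs))
     \<and> ncomplete (\<lambda>p. sqrt (Re (ip p p))) P"

definition pontryagin :: "('a::cvec \<Rightarrow> 'a \<Rightarrow> complex) \<Rightarrow> bool" where
  "pontryagin ip \<longleftrightarrow> sesq_herm ip \<and> (\<exists>P N. adm_decomp ip P N)"

definition jnorm :: "('a::cvec \<Rightarrow> 'a \<Rightarrow> complex) \<Rightarrow> 'a set \<Rightarrow> 'a set \<Rightarrow> 'a \<Rightarrow> real" where
  "jnorm ip P N x = (THE r. \<exists>p\<in>P. \<exists>n\<in>N. x = p + n \<and> r = sqrt (Re (ip p p) - Re (ip n n)))"

text \<open>Closure with respect to the (decomposition independent) topology of the Pontryagin space.\<close>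
definition pclosure :: "('a::cvec \<Rightarrow> 'a \<Rightarrow> complex) \<Rightarrow> 'a set \<Rightarrow> 'a set" where
  "pclosure ip S = {x. \<forall>P N. adm_decomp ip P N \<longrightarrow>
      (\<exists>xs. (\<forall>k. xs k \<in> S) \<and> (\<lambda>k. jnorm ip P N (xs k - x)) \<longlonglongrightarrow> 0)}"

definition pclosed :: "('a::cvec \<Rightarrow> 'a \<Rightarrow> complex) \<Rightarrow> 'a set \<Rightarrow> bool" where
  "pclosed ip S \<longleftrightarrow> pclosure ip S \<subseteq> S"

definition orth :: "('a::cvec \<Rightarrow> 'a \<Rightarrow> complex) \<Rightarrow> 'a set \<Rightarrow> 'a set" where
  "orth ip S = {y. \<forall>x\<in>S. ip x y = 0}"

definition orth_dsum :: "('a::cvec \<Rightarrow> 'a \<Rightarrow> complex) \<Rightarrow> 'a set \<Rightarrow> 'a set \<Rightarrow> 'a set \<Rightarrow> bool" where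
  "orth_dsum ip A B S \<longleftrightarrow> S = ssum A B \<and> A \<inter> B = {0} \<and> (\<forall>a\<in>A. \<forall>b\<in>B. ip a b = 0)"

definition nondegenerate :: "('a::cvec \<Rightarrow> 'a \<Rightarrow> complex) \<Rightarrow> 'a set \<Rightarrow> bool" where
  "nondegenerate ip S \<longleftrightarrow> S \<inter> orth ip S = {0}"

definition neutral :: "('a::cvec \<Rightarrow> 'a \<Rightarrow> complex) \<Rightarrow> 'a set \<Rightarrow> bool" where
  "neutral ip S \<longleftrightarrow> (\<forall>x\<in>S. ip x x = 0)"

definition skewly_linked :: "('a::cvec \<Rightarrow> 'a \<Rightarrow> complex) \<Rightarrow> 'a set \<Rightarrow> 'a set \<Rightarrow> bool" where
  "skewly_linked ip M N \<longleftrightarrow> M \<inter> orth ip N = {0} \<and> N \<inter> orth ip M = {0}"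

definition neg_dim :: "('a::cvec \<Rightarrow> 'a \<Rightarrow> complex) \<Rightarrow> 'a set \<Rightarrow> nat \<Rightarrow> bool" where
  "neg_dim ip S d \<longleftrightarrow> (\<exists>vs. length vs = d \<and> set vs \<subseteq> S \<and>
     (\<forall>cs. length cs = d \<and> (\<exists>c\<in>set cs. c \<noteq> 0) \<longrightarrow> Re (ip (lincomb cs vs) (lincomb cs vs)) < 0))"

definition has_neg_index :: "('a::cvec \<Rightarrow> 'a \<Rightarrow> complex) \<Rightarrow> 'a set \<Rightarrow> nat \<Rightarrow> bool" where
  "has_neg_index ip S k \<longleftrightarrow> neg_dim ip S k \<and> (\<forall>d. neg_dim ip S d \<longrightarrow> d \<le> k)"

definition unit_equiv :: "('a::cvec \<Rightarrow> 'a \<Rightarrow> complex) \<Rightarrow> 'a set \<Rightarrow>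
    ('b::cvec \<Rightarrow> 'b \<Rightarrow> complex) \<Rightarrow> 'b set \<Rightarrow> bool" where
  "unit_equiv ip S ip' T \<longleftrightarrow> (\<exists>U. bij_betw U S T
     \<and> (\<forall>x\<in>S. \<forall>y\<in>S. U (x + y) = U x + U y)
     \<and> (\<forall>c. \<forall>x\<in>S. U (scaleC c x) = scaleC c (U x))
     \<and> (\<forall>x\<in>S. \<forall>y\<in>S. ip' (U x) (U y) = ip x y))"

definition bnd_op :: "('a::cvec \<Rightarrow> real) \<Rightarrow> ('b::cvec \<Rightarrow> real) \<Rightarrow> ('a \<Rightarrow> 'b) \<Rightarrow> bool" where
  "bnd_op nx ny T \<longleftrightarrow> clinear T \<and> (\<exists>C. \<forall>x. ny (T x) \<le> C * nx x)"

definition bnd_HK :: "('h::cvec \<Rightarrow> 'h \<Rightarrow> complex) \<Rightarrow> ('k::cvec \<Rightarrow> 'k \<Rightarrow> complex) \<Rightarrow> ('h \<Rightarrow> 'k) \<Rightarrow> bool" where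
  "bnd_HK hip ip T \<longleftrightarrow> (\<forall>P N. adm_decomp ip P N \<longrightarrow> bnd_op (hnorm hip) (jnorm ip P N) T)"

definition bnd_KK :: "('k::cvec \<Rightarrow> 'k \<Rightarrow> complex) \<Rightarrow> ('k \<Rightarrow> 'k) \<Rightarrow> bool" where
  "bnd_KK ip T \<longleftrightarrow> (\<forall>P N. adm_decomp ip P N \<longrightarrow> bnd_op (jnorm ip P N) (jnorm ip P N) T)"

definition rel_adjoint :: "('k::cvec \<Rightarrow> 'k \<Rightarrow> complex) \<Rightarrow> ('k \<times> 'k) set \<Rightarrow> ('k \<times> 'k) set" where
  "rel_adjoint ip A = {(g, g'). \<forall>(f, f')\<in>A. ip f' g = ip f g'}"

definition selfadjoint_rel :: "('k::cvec \<Rightarrow> 'k \<Rightarrow> complex) \<Rightarrow> ('k \<times> 'k) set \<Rightarrow> bool" where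
  "selfadjoint_rel ip A \<longleftrightarrow> csubspace A \<and> A = rel_adjoint ip A"

definition res_rel :: "('k::cvec \<times> 'k) set \<Rightarrow> complex \<Rightarrow> ('k \<times> 'k) set" where
  "res_rel A z = {(f' - scaleC z f, f) | f f'. (f, f') \<in> A}"

definition resolvent_set :: "('k::cvec \<Rightarrow> 'k \<Rightarrow> complex) \<Rightarrow> ('k \<times> 'k) set \<Rightarrow> complex set" where
  "resolvent_set ip A = {z. \<exists>T. bnd_KK ip T \<and> res_rel A z = {(x, T x) | x. True}}"

definition resolvent :: "('k::cvec \<times> 'k) set \<Rightarrow> complex \<Rightarrow> 'k \<Rightarrow> 'k" where
  "resolvent A z x = (THE y. (x, y) \<in> res_rel A z)"

definition Gamma_z :: "('k::cvec \<times> 'k) set \<Rightarrow> ('h \<Rightarrow> 'k) \<Rightarrow> complex \<Rightarrow> complex \<Rightarrow> 'h \<Rightarrow> 'k" where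
  "Gamma_z A \<Gamma> z0 z h = \<Gamma> h + scaleC (z - z0) (resolvent A z (\<Gamma> h))"

definition mat_qf :: "(nat \<Rightarrow> nat \<Rightarrow> complex) \<Rightarrow> nat \<Rightarrow> (nat \<Rightarrow> complex) \<Rightarrow> complex" where
  "mat_qf M n x = (\<Sum>i<n. \<Sum>j<n. M i j * x j * cnj (x i))"

definition mat_neg_dim :: "(nat \<Rightarrow> nat \<Rightarrow> complex) \<Rightarrow> nat \<Rightarrow> nat \<Rightarrow> bool" where
  "mat_neg_dim M n d \<longleftrightarrow> (\<exists>v :: nat \<Rightarrow> nat \<Rightarrow> complex. \<forall>c :: nat \<Rightarrow> complex.
     (\<exists>k<d. c k \<noteq> 0) \<longrightarrow> Re (mat_qf M n (\<lambda>i. \<Sum>k<d. c k * v k i)) < 0)"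

definition nker :: "('h::cvec \<Rightarrow> 'h \<Rightarrow> complex) \<Rightarrow> (complex \<Rightarrow> 'h \<Rightarrow> 'h) \<Rightarrow>
    complex \<Rightarrow> 'h \<Rightarrow> complex \<Rightarrow> 'h \<Rightarrow> complex" where
  "nker hip Q z h w g = (hip (Q z h) g - hip (Q (cnj w) h) g) / (z - cnj w)"

definition kernel_neg_squares :: "('h::cvec \<Rightarrow> 'h \<Rightarrow> complex) \<Rightarrow> (complex \<Rightarrow> 'h \<Rightarrow> 'h) \<Rightarrow>
    complex set \<Rightarrow> nat \<Rightarrow> bool" where
  "kernel_neg_squares hip Q D \<kappa> \<longleftrightarrow>
     (\<forall>n (zs :: nat \<Rightarrow> complex) (hs :: nat \<Rightarrow> 'h) d.
        (\<forall>i<n. zs i \<in> D) \<and> (\<forall>i<n. \<forall>j<n. zs i \<noteq> cnj (zs j)) \<and>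
        mat_neg_dim (\<lambda>i j. nker hip Q (zs j) (hs j) (zs i) (hs i)) n d \<longrightarrow> d \<le> \<kappa>)
   \<and> (\<exists>n (zs :: nat \<Rightarrow> complex) (hs :: nat \<Rightarrow> 'h).
        (\<forall>i<n. zs i \<in> D) \<and> (\<forall>i<n. \<forall>j<n. zs i \<noteq> cnj (zs j)) \<and>
        mat_neg_dim (\<lambda>i j. nker hip Q (zs j) (hs j) (zs i) (hs i)) n \<kappa>)"

text \<open>\<open>Q \<in> N\<^sub>\<kappa>(\<H>)\<close> with domain of holomorphy \<open>D\<close>: \<open>Q\<close> is meromorphic in \<open>\<complex>\<setminus>\<real>\<close>
  (holomorphic on \<open>D\<close>, at the remaining non-real points -- which are isolated -- it has poles),
  \<open>Q(cnj z)\<^sup>* = Q z\<close>, and the kernel has exactly \<open>\<kappa>\<close> negative squares.\<close>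
definition nevanlinna :: "('h::cvec \<Rightarrow> 'h \<Rightarrow> complex) \<Rightarrow> nat \<Rightarrow> (complex \<Rightarrow> 'h \<Rightarrow> 'h) \<Rightarrow>
    complex set \<Rightarrow> bool" where
  "nevanlinna hip \<kappa> Q D \<longleftrightarrow>
     open D \<and> D \<subseteq> {z. Im z \<noteq> 0} \<and> (\<forall>z. z \<in> D \<longleftrightarrow> cnj z \<in> D)
     \<and> (\<forall>w. Im w \<noteq> 0 \<longrightarrow> \<not> w islimpt ({z. Im z \<noteq> 0} - D))
     \<and> (\<forall>z\<in>D. bnd_op (hnorm hip) (hnorm hip) (Q z))
     \<and> (\<forall>h g. (\<lambda>z. hip (Q z h) g) holomorphic_on D)
     \<and> (\<forall>w. Im w \<noteq> 0 \<and> w \<notin> D \<longrightarrow> (\<exists>m::nat. \<exists>C r. r > 0 \<and>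
           (\<forall>z\<in>D \<inter> ball w r. \<forall>h. hnorm hip (scaleC ((z - w) ^ m) (Q z h)) \<le> C * hnorm hip h)))
     \<and> (\<forall>z\<in>D. \<forall>h g. hip (Q (cnj z) h) g = hip h (Q z g))
     \<and> kernel_neg_squares hip Q D \<kappa>"

text \<open>\<open>(\<K>, A, \<Gamma>)\<close> with base point \<open>z\<^sub>0\<close> represents \<open>Q\<close>:
  \<open>Q z = Q(z\<^sub>0)\<^sup>* + (z - cnj z\<^sub>0) \<Gamma>\<^sup>+ \<Gamma>\<^sub>z\<close>, written weakly:
  \<open>(Q z h, g) = (h, Q z\<^sub>0 g) + (z - cnj z\<^sub>0) [\<Gamma>\<^sub>z h, \<Gamma> g]\<close>.\<close>
definition represents :: "('h::cvec \<Rightarrow> 'h \<Rightarrow> complex) \<Rightarrow> ('k::cvec \<Rightarrow> 'k \<Rightarrow> complex) \<Rightarrow>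
    ('k \<times> 'k) set \<Rightarrow> ('h \<Rightarrow> 'k) \<Rightarrow> complex \<Rightarrow> (complex \<Rightarrow> 'h \<Rightarrow> 'h) \<Rightarrow> complex set \<Rightarrow> bool" where
  "represents hip ip A \<Gamma> z0 Q D \<longleftrightarrow>
     pontryagin ip \<and> selfadjoint_rel ip A \<and> z0 \<in> resolvent_set ip A \<and> z0 \<in> D
     \<and> D \<subseteq> resolvent_set ip A \<and> bnd_HK hip ip \<Gamma>
     \<and> (\<forall>z\<in>D. \<forall>h g. hip (Q z h) g = hip h (Q z0 g) + (z - cnj z0) * ip (Gamma_z A \<Gamma> z0 z h) (\<Gamma> g))"

definition minimally_represents :: "('h::cvec \<Rightarrow> 'h \<Rightarrow> complex) \<Rightarrow> ('k::cvec \<Rightarrow> 'k \<Rightarrow> complex) \<Rightarrow>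
    ('k \<times> 'k) set \<Rightarrow> ('h \<Rightarrow> 'k) \<Rightarrow> complex \<Rightarrow> (complex \<Rightarrow> 'h \<Rightarrow> 'h) \<Rightarrow> complex set \<Rightarrow> bool" where
  "minimally_represents hip ip A \<Gamma> z0 Q D \<longleftrightarrow> represents hip ip A \<Gamma> z0 Q D
     \<and> pclosure ip (cspan {Gamma_z A \<Gamma> z0 z h | z h. z \<in> D}) = UNIV"

definition sum_ip :: "('a::cvec \<Rightarrow> 'a \<Rightarrow> complex) \<Rightarrow> ('b::cvec \<Rightarrow> 'b \<Rightarrow> complex) \<Rightarrow>
    'a \<times> 'b \<Rightarrow> 'a \<times> 'b \<Rightarrow> complex" where
  "sum_ip ip1 ip2 x y = ip1 (fst x) (fst y) + ip2 (snd x) (snd y)"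

definition sum_L :: "('a::cvec \<times> 'a) set \<Rightarrow> ('h \<Rightarrow> 'a) \<Rightarrow> ('b::cvec \<times> 'b) set \<Rightarrow> ('h \<Rightarrow> 'b) \<Rightarrow>
    complex \<Rightarrow> complex set \<Rightarrow> ('a \<times> 'b) set" where
  "sum_L A1 \<Gamma>1 A2 \<Gamma>2 z0 D = cspan {(Gamma_z A1 \<Gamma>1 z0 z h, Gamma_z A2 \<Gamma>2 z0 z h) | z h. z \<in> D}"

end

theory Submission
  imports Defs
begin

text \<open>
  By self-adjointness of the representing relations the vectors \<open>\<Gamma>\<^sub>z h\<close> of the minimal representation
  and the pairs \<open>(\<Gamma>\<^sub>1\<^sub>z h, \<Gamma>\<^sub>2\<^sub>z h)\<close> have the same Gram matrix, the kernel of \<open>Q\<close>. Matching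
  them gives an isometric linear relation with dense range in the state space of \<open>Q\<close> whose domain,
  projected along \<open>L0\<close>, is dense in \<open>L1\<close>. It extends to a unitary map because in a
  Pontryagin space a sequence converges as soon as the self products of its differences tend to \<open>0\<close>
  and its products with a dense set of vectors converge. A negative definite family of vectors
  stays so under small perturbation, so it may be moved into the span of the \<open>\<Gamma>\<^sub>z h\<close>, where the
  Gram matrix identifies the negative index with the number of negative squares.
\<close>

subsection \<open>Complex vector spaces\<close>

text \<open>An indefinite form yields no norm, so preserving it is not by itself a bound, and
  convergence of images has to be proved from scalar products. All estimates are made in the norm of
  one fixed fundamental decomposition. There are two further obstacles. The vectors of the domain
  may carry an isotropic part that no product with the domain detects; it has no control in norm and
  must be split off before limits are taken. At z = \<open>cnj w\<close> the kernel of
  \<open>Q\<close> is a quotient with denominator zero, hence 0, while the product of the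
  representing vectors need not vanish; so only points of \<open>generic D\<close>, no two of which
  are conjugate, are used as generators. The Gram entries do not involve the base point, which makes
  representations with base points \<open>z0\<close> and \<open>w0\<close> comparable.\<close>

interpretation cv: vector_space "scaleC :: complex \<Rightarrow> 'a::cvec \<Rightarrow> 'a"
  by standard (simp_all add: scaleC_add_right scaleC_add_left scaleC_scaleC scaleC_one)

lemma csubspace_iff: "csubspace S \<longleftrightarrow> cv.subspace S"
  by (simp add: csubspace_def cv.subspace_def)

lemma lincomb_Cons: "lincomb (c # cs) (v # vs) = scaleC c v + lincomb cs vs"
  by (simp add: lincomb_def)

lemma lincomb_in_span:
  "length cs = length vs \<Longrightarrow> set vs \<subseteq> S \<Longrightarrow> lincomb cs vs \<in> cv.span S"
proof (induction cs vs rule: list_induct2)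
  case Nil
  then show ?case by (simp add: lincomb_def cv.span_zero)
next
  case (Cons c cs v vs)
  then show ?case
    by (auto simp: lincomb_Cons intro!: cv.span_add cv.span_scale intro: cv.span_base)
qed

lemma lincomb_nth:
  "length cs = length vs \<Longrightarrow> lincomb cs vs = (\<Sum>k<length vs. scaleC (cs ! k) (vs ! k))"
  by (simp add: lincomb_def sum_list_sum_nth atLeast0LessThan)

lemma cspan_eq_span: "cspan S = cv.span S"
proof
  show "cspan S \<subseteq> cv.span S"
    by (auto simp: cspan_def intro: lincomb_in_span)
  show "cv.span S \<subseteq> cspan S"
  proof
    fix x assume "x \<in> cv.span S"
    then show "x \<in> cspan S"
    proof (induction rule: cv.span_induct_alt)
      case base
      have "length ([]::complex list) = length ([]::'a list) \<and> set [] \<subseteq> S \<and> 0 = lincomb [] ([]::'a list)"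
        by (simp add: lincomb_def)
      then show ?case unfolding cspan_def by blast
    next
      case (step c x y)
      then obtain cs vs where "length cs = length vs" "set vs \<subseteq> S" "y = lincomb cs vs"
        by (auto simp: cspan_def)
      with step(1) have "length (c # cs) = length (x # vs) \<and> set (x # vs) \<subseteq> S
          \<and> scaleC c x + y = lincomb (c # cs) (x # vs)"
        by (simp add: lincomb_Cons)
      then show ?case unfolding cspan_def by blast
    qed
  qed
qed

text \<open>Each vector has its own finite support; the union of the supports serves all of them at
  once. Enumerating it by natural numbers gives the single index range \<open>n\<close> on which
  \<open>mat_neg_dim\<close> works.\<close>

lemma span_finite_family:
  fixes d :: nat
  assumes "\<And>k. k < d \<Longrightarrow> u k \<in> cv.span B"
  shows "\<exists>(n::nat) g a. (\<forall>i<n. g i \<in> B) \<and> (\<forall>k<d. u k = (\<Sum>i<n. scaleC (a k i) (g i)))"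
proof -
  have "\<forall>k\<in>{..<d}. \<exists>t. finite t \<and> t \<subseteq> B \<and> u k \<in> cv.span t"
  proof
    fix k assume "k \<in> {..<d}"
    then obtain t r where "finite t" "t \<subseteq> B" "u k = (\<Sum>a\<in>t. scaleC (r a) a)"
      using assms[of k] by (auto simp: cv.span_explicit)
    then show "\<exists>t. finite t \<and> t \<subseteq> B \<and> u k \<in> cv.span t"
      by (intro exI[of _ t]) (auto intro!: cv.span_sum cv.span_scale intro: cv.span_base)
  qed
  then obtain t where t: "\<And>k. k < d \<Longrightarrow> finite (t k) \<and> t k \<subseteq> B \<and> u k \<in> cv.span (t k)"
    by (metis lessThan_iff)
  define S where "S = (\<Union>k<d. t k)"
  have S: "finite S" "S \<subseteq> B" using t by (auto simp: S_def intro!: finite_UN_I)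
  have uS: "\<exists>r. u k = (\<Sum>v\<in>S. scaleC (r v) v)" if "k < d" for k
  proof -
    have "u k \<in> cv.span S"
      using t[OF that] cv.span_mono[of "t k" S] that by (auto simp: S_def)
    then show ?thesis using cv.span_finite[OF S(1)] by auto
  qed
  then obtain r where r: "\<And>k. k < d \<Longrightarrow> u k = (\<Sum>v\<in>S. scaleC (r k v) v)" by metis
  obtain g where g: "bij_betw g {..<card S} S"
    using ex_bij_betw_nat_finite[OF S(1)] by (auto simp: atLeast0LessThan)
  show ?thesis
  proof (intro exI[of _ "card S"] exI[of _ g] exI[of _ "\<lambda>k i. r k (g i)"] conjI allI impI)
    show "g i \<in> B" if "i < card S" for i
      using g S(2) that by (auto simp: bij_betw_def)
    show "u k = (\<Sum>i<card S. scaleC (r k (g i)) (g i))" if "k < d" for k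
      unfolding r[OF that] by (rule sum.reindex_bij_betw[OF g, symmetric])
  qed
qed

subsection \<open>Hermitian forms\<close>

locale hermitian =
  fixes ip :: "'a::cvec \<Rightarrow> 'a \<Rightarrow> complex"
  assumes herm: "sesq_herm ip"
begin

lemma add_left: "ip (x + y) z = ip x z + ip y z"
  and scale_left: "ip (scaleC c x) y = c * ip x y"
  and sym: "ip y x = cnj (ip x y)"
  using herm unfolding sesq_herm_def by blast+

lemma add_right: "ip x (y + z) = ip x y + ip x z"
  by (metis sym add_left complex_cnj_add)

lemma scale_right: "ip x (scaleC c y) = cnj c * ip x y"
  by (metis sym scale_left complex_cnj_mult)

lemma zero_left [simp]: "ip 0 y = 0"
  using scale_left[of 0 0 y] by simp

lemma zero_right [simp]: "ip x 0 = 0"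
  using sym[of x 0] by simp

lemma minus_left: "ip (- x) y = - ip x y"
  using scale_left[of "-1" x y] by simp

lemma minus_right: "ip x (- y) = - ip x y"
  using scale_right[of x "-1" y] by simp

lemma diff_left: "ip (x - y) z = ip x z - ip y z"
  using add_left[of x "- y" z] by (simp add: minus_left)

lemma diff_right: "ip x (y - z) = ip x y - ip x z"
  using add_right[of x y "- z"] by (simp add: minus_right)

lemma sum_left: "ip (sum f S) y = (\<Sum>i\<in>S. ip (f i) y)"
  by (induction S rule: infinite_finite_induct) (auto simp: add_left)

lemma sum_right: "ip x (sum f S) = (\<Sum>i\<in>S. ip x (f i))"
  by (induction S rule: infinite_finite_induct) (auto simp: add_right)

lemmas ip_simps = add_left add_right diff_left diff_right minus_left minus_right
  scale_left scale_right

lemma self_real: "ip x x = complex_of_real (Re (ip x x))"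
  using sym[of x x] by (metis Reals_cnj_iff of_real_Re)

lemma eq_zero_sym: "ip x y = 0 \<longleftrightarrow> ip y x = 0"
  by (metis sym complex_cnj_zero_iff)

text \<open>\<open>mat_qf\<close> conjugates the row variable, and \<open>ip\<close> is linear in
  its first argument; hence the entry in row \<open>i\<close> and column \<open>j\<close> has
  \<open>g j\<close> on the left.\<close>

lemma qf: "ip (\<Sum>i<n. scaleC (x i) (g i)) (\<Sum>i<n. scaleC (x i) (g i))
    = mat_qf (\<lambda>i j. ip (g j) (g i)) n x"
  unfolding mat_qf_def
  by (simp add: sum_left sum_right scale_left scale_right sum_distrib_left mult_ac)

text \<open>The vectors \<open>e i\<close> are either zero or normalised to \<open>-1\<close>, so that linearly
  dependent families need no special treatment.\<close>
lemma gram_schmidt: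
  fixes f :: "nat \<Rightarrow> 'a"
  assumes "\<And>c. Re (ip (\<Sum>k<d. scaleC (c k) (f k)) (\<Sum>k<d. scaleC (c k) (f k))) < 0
      \<or> (\<Sum>k<d. scaleC (c k) (f k)) = 0"
  shows "\<exists>e. (\<forall>i<d. \<forall>j<d. i \<noteq> j \<longrightarrow> ip (e i) (e j) = 0)
     \<and> (\<forall>i<d. e i = 0 \<or> ip (e i) (e i) = -1)
     \<and> (\<forall>i<d. \<exists>c. c i \<noteq> 0 \<and> e i = (\<Sum>k<d. scaleC (c k) (f k)))
     \<and> (\<forall>i<d. f i = - (\<Sum>j<d. scaleC (ip (f i) (e j)) (e j)))"
  using assms
proof (induction d)
  case 0
  then show ?case by simp
next
  case (Suc d)
  have ext: "(\<Sum>k<d. scaleC (c k) (f k)) = (\<Sum>k<Suc d. scaleC ((c(d := 0)) k) (f k))" for c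
    by simp
  have "Re (ip (\<Sum>k<d. scaleC (c k) (f k)) (\<Sum>k<d. scaleC (c k) (f k))) < 0
      \<or> (\<Sum>k<d. scaleC (c k) (f k)) = 0" for c
    unfolding ext by (rule Suc.prems)
  from Suc.IH[OF this] obtain e where
    E: "\<forall>i<d. \<forall>j<d. i \<noteq> j \<longrightarrow> ip (e i) (e j) = 0"
      "\<forall>i<d. e i = 0 \<or> ip (e i) (e i) = -1"
      "\<forall>i<d. \<exists>c. c i \<noteq> 0 \<and> e i = (\<Sum>k<d. scaleC (c k) (f k))"
      "\<forall>i<d. f i = - (\<Sum>j<d. scaleC (ip (f i) (e j)) (e j))"
    by (elim exE conjE)
  have e1: "\<And>i j. i < d \<Longrightarrow> j < d \<Longrightarrow> i \<noteq> j \<Longrightarrow> ip (e i) (e j) = 0"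
    and e2: "\<And>i. i < d \<Longrightarrow> e i = 0 \<or> ip (e i) (e i) = -1"
    and e3: "\<And>i. i < d \<Longrightarrow> \<exists>c. c i \<noteq> 0 \<and> e i = (\<Sum>k<d. scaleC (c k) (f k))"
    and e4: "\<And>i. i < d \<Longrightarrow> f i = - (\<Sum>j<d. scaleC (ip (f i) (e j)) (e j))"
    using E by simp_all
  have "\<forall>i. \<exists>c. i < d \<longrightarrow> e i = (\<Sum>k<d. scaleC (c k) (f k))" using e3 by blast
  from choice[OF this] obtain a where a: "\<And>i. i < d \<Longrightarrow> e i = (\<Sum>k<d. scaleC (a i k) (f k))"
    by blast
  \<comment> \<open>The projection is added rather than subtracted because the nonzero
    \<open>e j\<close> have self product -1.\<close>
  define v where "v = f d + (\<Sum>j<d. scaleC (ip (f d) (e j)) (e j))"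
  define b where "b k = (if k = d then 1 else \<Sum>j<d. ip (f d) (e j) * a j k)" for k
  have v_comb: "v = (\<Sum>k<Suc d. scaleC (b k) (f k))"
  proof -
    have "scaleC (ip (f d) (e j)) (e j) = (\<Sum>k<d. scaleC (ip (f d) (e j) * a j k) (f k))"
      if "j < d" for j
      using arg_cong[OF a[OF that], of "scaleC (ip (f d) (e j))"] by (simp add: cv.scale_sum_right)
    then have "(\<Sum>j<d. scaleC (ip (f d) (e j)) (e j))
      = (\<Sum>j<d. \<Sum>k<d. scaleC (ip (f d) (e j) * a j k) (f k))"
      by (intro sum.cong refl) simp
    also have "\<dots> = (\<Sum>k<d. scaleC (b k) (f k))"
      by (subst sum.swap) (auto simp: b_def cv.scale_sum_left intro!: sum.cong)
    finally show ?thesis by (simp add: v_def b_def)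
  qed
  have v_orth: "ip v (e i) = 0" if "i < d" for i
  proof -
    have "(\<Sum>j<d. ip (f d) (e j) * ip (e j) (e i)) = ip (f d) (e i) * ip (e i) (e i)"
      using that e1 by (subst sum.remove[of _ i]) (auto intro!: sum.neutral)
    moreover have "ip (f d) (e i) * ip (e i) (e i) = - ip (f d) (e i)"
      using e2[OF that] by auto
    ultimately show ?thesis by (simp add: v_def ip_simps sum_left)
  qed
  have v_cases: "v = 0 \<or> Re (ip v v) < 0"
    unfolding v_comb using Suc.prems[of b] by auto
  \<comment> \<open>For \<open>v = 0\<close> the value 1 keeps the coefficient
    \<open>s * b d\<close> of \<open>f d\<close> nonzero, as the third claim also covers vanishing
    \<open>e i\<close>.\<close>
  define s where "s = (if v = 0 then 1 else complex_of_real (1 / sqrt (- Re (ip v v))))"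
  have s0: "s \<noteq> 0" using v_cases by (auto simp: s_def)
  define w where "w = scaleC s v"
  have w_norm: "w = 0 \<or> ip w w = -1"
  proof (cases "v = 0")
    case False
    then have n: "Re (ip v v) < 0" using v_cases by auto
    define r where "r = - Re (ip v v)"
    have "r > 0" using n by (simp add: r_def)
    have "ip v v = - complex_of_real r" using self_real[of v] by (simp add: r_def)
    moreover have "s = complex_of_real (1 / sqrt r)" using False by (simp add: s_def r_def)
    ultimately have "ip w w = - complex_of_real ((1 / sqrt r) * (1 / sqrt r) * r)"
      by (simp only: w_def scale_left scale_right complex_cnj_complex_of_real of_real_mult) simp
    also have "(1 / sqrt r) * (1 / sqrt r) * r = 1" using \<open>r > 0\<close> by simp
    finally show ?thesis by simp
  qed (simp add: w_def)
  have w_orth: "ip w (e i) = 0" "ip (e i) w = 0" if "i < d" for i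
    using v_orth[OF that] eq_zero_sym[of v "e i"] by (auto simp: w_def ip_simps)
  have fd: "f d = - (\<Sum>j<d. scaleC (ip (f d) (e j)) (e j)) - scaleC (ip (f d) w) w"
  proof -
    have 1: "f d = v - (\<Sum>j<d. scaleC (ip (f d) (e j)) (e j))" by (simp add: v_def)
    have 2: "ip (f d) w = ip v w"
      by (subst 1) (simp add: ip_simps sum_left w_orth)
    have "v = - scaleC (ip v w) w"
    proof (cases "v = 0")
      case False
      then have "w \<noteq> 0" using s0 by (simp add: w_def)
      then have "ip w w = -1" using w_norm by auto
      then have "s * ip v w = -1" by (simp add: w_def ip_simps mult_ac)
      then have "- scaleC (ip v w) w = scaleC (- (ip v w * s)) v"
        by (simp add: w_def)
      also have "- (ip v w * s) = 1" using \<open>s * ip v w = -1\<close> by (simp add: mult.commute)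
      finally show ?thesis by simp
    qed (simp add: w_def)
    with 1 2 show ?thesis by (metis add.commute uminus_add_conv_diff)
  qed
  have fi: "ip (f i) w = 0" if "i < d" for i
    by (subst e4[OF that]) (simp add: ip_simps sum_left w_orth)
  define e' where "e' i = (if i = d then w else e i)" for i
  have e'[simp]: "i < d \<Longrightarrow> e' i = e i" "e' d = w" for i by (auto simp: e'_def)
  show ?case
  proof (intro exI[of _ e'] conjI allI impI)
    fix i j assume "i < Suc d" "j < Suc d" "i \<noteq> j"
    then show "ip (e' i) (e' j) = 0" using e1 w_orth by (auto simp: less_Suc_eq)
  next
    fix i assume "i < Suc d"
    then show "e' i = 0 \<or> ip (e' i) (e' i) = -1" using e2[of i] w_norm by (cases "i = d") auto
  next
    fix i assume "i < Suc d"
    then consider "i < d" | "i = d" by linarith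
    then show "\<exists>c. c i \<noteq> 0 \<and> e' i = (\<Sum>k<Suc d. scaleC (c k) (f k))"
    proof cases
      case 1
      then obtain c where "c i \<noteq> 0" "e i = (\<Sum>k<d. scaleC (c k) (f k))" using e3 by blast
      with 1 show ?thesis by (intro exI[of _ "c(d := 0)"]) auto
    next
      case 2
      have "w = (\<Sum>k<Suc d. scaleC (s * b k) (f k))"
        unfolding w_def v_comb cv.scale_sum_right cv.scale_scale ..
      moreover have "s * b d \<noteq> 0" using s0 by (simp add: b_def)
      ultimately show ?thesis using 2 by (intro exI[of _ "\<lambda>k. s * b k"]) simp
    qed
  next
    fix i assume "i < Suc d"
    then show "f i = - (\<Sum>j<Suc d. scaleC (ip (f i) (e' j)) (e' j))"
      using e4 fd fi by (auto simp: less_Suc_eq)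
  qed
qed

end

text \<open>Taking t = s * \<open>ip x y\<close> with real \<open>s\<close> turns positivity at x -
  t y into a real quadratic inequality in \<open>s\<close>, evaluated at its minimum. The form may
  be only semidefinite, so a \<open>y\<close> with self product 0 is treated separately: there a
  nonconstant linear function of \<open>s\<close> would be bounded below.\<close>

lemma (in hermitian) cauchy_schwarz:
  assumes pos: "\<And>x. 0 \<le> Re (ip x x)"
  shows "(cmod (ip x y))\<^sup>2 \<le> Re (ip x x) * Re (ip y y)"
proof -
  define B where "B = (cmod (ip x y))\<^sup>2"
  have Bc: "complex_of_real B = ip x y * cnj (ip x y)"
    by (simp add: B_def complex_norm_square[symmetric])
  have q: "0 \<le> Re (ip x x) - 2 * s * B + s\<^sup>2 * B * Re (ip y y)" for s :: real
  proof -
    define t where "t = complex_of_real s * ip x y"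
    have "ip (x - scaleC t y) (x - scaleC t y)
       = ip x x - cnj t * ip x y - t * cnj (ip x y) + t * cnj t * ip y y"
      by (simp add: ip_simps sym[of y x] algebra_simps)
    also have "\<dots> = ip x x - 2 * complex_of_real s * complex_of_real B
        + (complex_of_real s)\<^sup>2 * complex_of_real B * ip y y"
      unfolding Bc by (simp add: t_def power2_eq_square algebra_simps)
    also have "\<dots> = complex_of_real (Re (ip x x) - 2 * s * B + s\<^sup>2 * B * Re (ip y y))"
      by (subst (1 2) self_real) simp
    finally show ?thesis using pos[of "x - scaleC t y"] by simp
  qed
  have B0: "B \<ge> 0" by (simp add: B_def)
  have "B \<le> Re (ip x x) * Re (ip y y)"
  proof (cases "Re (ip y y) = 0")
    case True
    have "B = 0"
    proof (rule ccontr)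
      assume "B \<noteq> 0"
      \<comment> \<open>At this \<open>s\<close> the expression, now linear, equals -1.\<close>
      then show False using q[of "(Re (ip x x) + 1) / (2 * B)"] True by simp
    qed
    then show ?thesis using pos by simp
  next
    case False
    then have y: "Re (ip y y) > 0" using pos[of y] by simp
    have "0 \<le> Re (ip x x) - B / Re (ip y y)"
      using q[of "1 / Re (ip y y)"] y by (simp add: power2_eq_square)
    then show ?thesis using y by (simp add: field_simps)
  qed
  then show ?thesis by (simp add: B_def)
qed

lemma (in hermitian) norm_triangle:
  assumes pos: "\<And>x. 0 \<le> Re (ip x x)"
  shows "sqrt (Re (ip (x + y) (x + y))) \<le> sqrt (Re (ip x x)) + sqrt (Re (ip y y))"
proof -
  have "Re (ip x y) \<le> cmod (ip x y)" by (rule complex_Re_le_cmod)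
  also have "\<dots> \<le> sqrt (Re (ip x x)) * sqrt (Re (ip y y))"
    using cauchy_schwarz[OF pos, of x y] by (metis real_le_rsqrt real_sqrt_mult)
  finally have "Re (ip x y) \<le> sqrt (Re (ip x x)) * sqrt (Re (ip y y))" .
  moreover have "Re (ip (x + y) (x + y)) = Re (ip x x) + Re (ip y y) + 2 * Re (ip x y)"
    using sym[of x y] by (simp add: ip_simps)
  ultimately have "Re (ip (x + y) (x + y)) \<le> (sqrt (Re (ip x x)) + sqrt (Re (ip y y)))\<^sup>2"
    using pos[of x] pos[of y] by (simp add: power2_sum)
  then show ?thesis
    using pos[of x] pos[of y] by (intro real_le_lsqrt) auto
qed

subsection \<open>The norm of a fundamental decomposition\<close>

locale pontryagin_decomp = hermitian ip for ip :: "'a::cvec \<Rightarrow> 'a \<Rightarrow> complex" +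
  fixes P N :: "'a set"
  assumes dec: "adm_decomp ip P N"
begin

abbreviation nrm :: "'a \<Rightarrow> real" where "nrm \<equiv> jnorm ip P N"

lemma P_sub: "cv.subspace P" and N_sub: "cv.subspace N"
  and PN_span: "ssum P N = UNIV" and PN_int: "P \<inter> N = {0}"
  and PN_orth: "p \<in> P \<Longrightarrow> n \<in> N \<Longrightarrow> ip p n = 0"
  and P_pos: "p \<in> P \<Longrightarrow> p \<noteq> 0 \<Longrightarrow> Re (ip p p) > 0"
  and N_neg: "n \<in> N \<Longrightarrow> n \<noteq> 0 \<Longrightarrow> Re (ip n n) < 0"
  and N_fin: "\<exists>vs. N = cv.span (set vs)"
  and P_complete: "ncomplete (\<lambda>p. sqrt (Re (ip p p))) P"
  using dec by (auto simp: adm_decomp_def csubspace_iff cspan_eq_span)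

lemma NP_orth: "p \<in> P \<Longrightarrow> n \<in> N \<Longrightarrow> ip n p = 0"
  using PN_orth eq_zero_sym by blast

definition pp :: "'a \<Rightarrow> 'a" where "pp x = (THE p. p \<in> P \<and> x - p \<in> N)"
definition nn :: "'a \<Rightarrow> 'a" where "nn x = x - pp x"

lemma decomp_unique:
  assumes "p \<in> P" "p' \<in> P" "x - p \<in> N" "x - p' \<in> N" shows "p = p'"
proof -
  have "p - p' \<in> P" using assms(1,2) by (rule cv.subspace_diff[OF P_sub])
  moreover have "(x - p') - (x - p) \<in> N" using assms(4,3) by (rule cv.subspace_diff[OF N_sub])
  ultimately have "p - p' \<in> P \<inter> N" by simp
  then show ?thesis using PN_int by auto
qed

lemma pp_eq: "p \<in> P \<Longrightarrow> x - p \<in> N \<Longrightarrow> pp x = p"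
  unfolding pp_def by (rule the_equality) (auto intro: decomp_unique)

lemma pp_in: "pp x \<in> P" and nn_in: "nn x \<in> N"
proof -
  have "x \<in> ssum P N" by (simp add: PN_span)
  then obtain p n where pn: "p \<in> P" "n \<in> N" "x = p + n"
    unfolding ssum_def by blast
  then have "pp x = p" by (intro pp_eq) auto
  then show "pp x \<in> P" "nn x \<in> N" using pn by (auto simp: nn_def)
qed

lemma pp_nn: "pp x + nn x = x" by (simp add: nn_def)

lemma pp_add: "pp (x + y) = pp x + pp y"
proof (rule pp_eq)
  show "pp x + pp y \<in> P" using P_sub pp_in by (auto intro: cv.subspace_add)
  have "x + y - (pp x + pp y) = nn x + nn y" by (simp add: nn_def)
  then show "x + y - (pp x + pp y) \<in> N" using N_sub nn_in by (auto intro: cv.subspace_add)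
qed

lemma pp_scale: "pp (scaleC c x) = scaleC c (pp x)"
proof (rule pp_eq)
  show "scaleC c (pp x) \<in> P" using P_sub pp_in by (auto intro: cv.subspace_scale)
  have "scaleC c x - scaleC c (pp x) = scaleC c (nn x)" by (simp add: nn_def cv.scale_right_diff_distrib)
  then show "scaleC c x - scaleC c (pp x) \<in> N" using N_sub nn_in by (auto intro: cv.subspace_scale)
qed

lemma nn_add: "nn (x + y) = nn x + nn y"
  by (simp add: nn_def pp_add)

lemma nn_scale: "nn (scaleC c x) = scaleC c (nn x)"
  by (simp add: nn_def pp_scale cv.scale_right_diff_distrib)

lemma pp_diff: "pp (x - y) = pp x - pp y"
  using pp_add[of "x - y" y] by simp

lemma pp_P: "p \<in> P \<Longrightarrow> pp p = p"
  using N_sub by (intro pp_eq) (auto simp: cv.subspace_0)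

lemma pp_N: "n \<in> N \<Longrightarrow> pp n = 0"
  using P_sub by (intro pp_eq) (auto simp: cv.subspace_0)

text \<open>The positive definite form [J x, y] of the fundamental symmetry J = \<open>pp\<close> -
  \<open>nn\<close>.\<close>

definition hp :: "'a \<Rightarrow> 'a \<Rightarrow> complex" where
  "hp x y = ip (pp x) (pp y) - ip (nn x) (nn y)"

lemma hp_herm: "sesq_herm hp"
  unfolding sesq_herm_def
proof (intro conjI allI)
  fix x y z c
  show "hp (x + y) z = hp x z + hp y z" by (simp add: hp_def pp_add nn_add ip_simps)
  show "hp (scaleC c x) y = c * hp x y"
    by (simp add: hp_def pp_scale nn_scale ip_simps right_diff_distrib)
  show "hp y x = cnj (hp x y)"
    using sym[of "pp x" "pp y"] sym[of "nn x" "nn y"] by (simp add: hp_def)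
qed

lemma pp_nonneg: "0 \<le> Re (ip (pp x) (pp x))"
  using P_pos[OF pp_in[of x]] by (cases "pp x = 0") auto

lemma nn_nonpos: "Re (ip (nn x) (nn x)) \<le> 0"
  using N_neg[OF nn_in[of x]] by (cases "nn x = 0") auto

lemma hp_nonneg: "0 \<le> Re (hp x x)"
  using pp_nonneg[of x] nn_nonpos[of x] by (simp add: hp_def)

sublocale hp: hermitian hp by unfold_locales (rule hp_herm)

lemma nrm_hp: "nrm x = sqrt (Re (hp x x))"
  unfolding jnorm_def
proof (rule the_equality)
  show "\<exists>p\<in>P. \<exists>n\<in>N. x = p + n \<and> sqrt (Re (hp x x)) = sqrt (Re (ip p p) - Re (ip n n))"
    using pp_in nn_in pp_nn[of x] by (intro bexI[of _ "pp x"] bexI[of _ "nn x"]) (auto simp: hp_def)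
  fix r assume "\<exists>p\<in>P. \<exists>n\<in>N. x = p + n \<and> r = sqrt (Re (ip p p) - Re (ip n n))"
  then obtain p n where "p \<in> P" "n \<in> N" "x = p + n" "r = sqrt (Re (ip p p) - Re (ip n n))" by blast
  moreover from this have "pp x = p" by (intro pp_eq) auto
  ultimately show "r = sqrt (Re (hp x x))" by (simp add: hp_def nn_def)
qed

lemma nrm_nonneg [simp]: "0 \<le> nrm x"
  using hp_nonneg by (simp add: nrm_hp)

lemma nrm_sq: "(nrm x)\<^sup>2 = Re (ip (pp x) (pp x)) - Re (ip (nn x) (nn x))"
  using hp_nonneg[of x] by (simp add: nrm_hp hp_def)

lemma nrm_add: "nrm (x + y) \<le> nrm x + nrm y"
  unfolding nrm_hp by (rule hp.norm_triangle) (rule hp_nonneg)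

lemma nrm_scale: "nrm (scaleC c x) = cmod c * nrm x"
proof -
  have "hp (scaleC c x) (scaleC c x) = complex_of_real ((cmod c)\<^sup>2) * hp x x"
    unfolding complex_norm_square by (simp add: hp.ip_simps)
  then show ?thesis by (simp add: nrm_hp real_sqrt_mult)
qed

lemma nrm_zero [simp]: "nrm 0 = 0"
  using nrm_scale[of 0 0] by simp

lemma nrm_minus: "nrm (- x) = nrm x"
  using nrm_scale[of "-1" x] by simp

lemma nrm_commute: "nrm (x - y) = nrm (y - x)"
  using nrm_minus[of "x - y"] by simp

lemma nrm_diff_triangle: "nrm (x - z) \<le> nrm (x - y) + nrm (y - z)"
  using nrm_add[of "x - y" "y - z"] by simp

lemma nrm_sum: "nrm (sum f S) \<le> (\<Sum>i\<in>S. nrm (f i))"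
  by (induction S rule: infinite_finite_induct) (auto intro: order_trans[OF nrm_add])

lemma nrm_eq_0: "nrm x = 0 \<Longrightarrow> x = 0"
proof -
  assume "nrm x = 0"
  then have "Re (ip (pp x) (pp x)) - Re (ip (nn x) (nn x)) = 0" using nrm_sq[of x] by simp
  then have "Re (ip (pp x) (pp x)) = 0" "Re (ip (nn x) (nn x)) = 0"
    using pp_nonneg[of x] nn_nonpos[of x] by auto
  then have "pp x = 0" "nn x = 0"
    using P_pos[OF pp_in[of x]] N_neg[OF nn_in[of x]] by force+
  then show "x = 0" using pp_nn[of x] by simp
qed

lemma ip_pp_nn: "ip x y = ip (pp x) (pp y) + ip (nn x) (nn y)"
proof -
  have "ip x y = ip (pp x + nn x) (pp y + nn y)" by (simp add: pp_nn)
  then show ?thesis using PN_orth NP_orth pp_in nn_in by (simp add: ip_simps)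
qed

text \<open>With J y = \<open>pp y - nn y\<close> the product becomes \<open>hp\<close> of
  \<open>x\<close> and J y, and J preserves \<open>hp\<close>; Cauchy-Schwarz for \<open>hp\<close>
  then applies.\<close>

lemma ip_bound: "cmod (ip x y) \<le> nrm x * nrm y"
proof -
  define y' where "y' = pp y - nn y"
  have "pp y' = pp y" unfolding y'_def
    using N_sub nn_in pp_in by (intro pp_eq) (auto intro: cv.subspace_neg)
  then have y': "pp y' = pp y" "nn y' = - nn y" by (auto simp: nn_def y'_def)
  then have "ip x y = hp x y'" by (simp add: hp_def ip_pp_nn[of x y] ip_simps)
  moreover have "hp y' y' = hp y y" by (simp add: hp_def y' ip_simps)
  ultimately have "(cmod (ip x y))\<^sup>2 \<le> Re (hp x x) * Re (hp y y)"
    using hp.cauchy_schwarz[OF hp_nonneg, of x y'] by simp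
  then show ?thesis unfolding nrm_hp by (metis real_le_rsqrt real_sqrt_mult)
qed

lemma nondeg: "(\<And>y. ip x y = 0) \<Longrightarrow> x = 0"
proof -
  assume x: "\<And>y. ip x y = 0"
  have "ip x (pp x) = ip (pp x) (pp x)" "ip x (nn x) = ip (nn x) (nn x)"
    by (simp_all add: ip_pp_nn[of x] pp_P pp_N pp_in nn_in nn_def)
      (simp_all add: nn_def[symmetric] pp_N nn_in)
  then have "ip (pp x) (pp x) = 0" "ip (nn x) (nn x) = 0" using x by auto
  then have "nrm x = 0" using nrm_sq[of x] by simp
  then show "x = 0" by (rule nrm_eq_0)
qed

lemma ip_tendsto:
  assumes "(\<lambda>n. nrm (xs n - x)) \<longlonglongrightarrow> 0" "(\<lambda>n. nrm (ys n - y)) \<longlonglongrightarrow> 0"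
  shows "(\<lambda>n. ip (xs n) (ys n)) \<longlonglongrightarrow> ip x y"
proof -
  have "cmod (ip (xs n) (ys n) - ip x y)
      \<le> nrm (xs n - x) * nrm (ys n - y) + nrm (xs n - x) * nrm y + nrm x * nrm (ys n - y)" for n
  proof -
    have "ip (xs n) (ys n) - ip x y
      = ip (xs n - x) (ys n - y) + ip (xs n - x) y + ip x (ys n - y)"
      by (simp add: ip_simps)
    also have "cmod \<dots> \<le> cmod (ip (xs n - x) (ys n - y)) + cmod (ip (xs n - x) y) + cmod (ip x (ys n - y))"
      by (meson add_mono_thms_linordered_semiring(3) norm_triangle_ineq order_trans)
    finally show ?thesis
      using ip_bound[of "xs n - x" "ys n - y"] ip_bound[of "xs n - x" y] ip_bound[of x "ys n - y"]
      by linarith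
  qed
  moreover have "(\<lambda>n. nrm (xs n - x) * nrm (ys n - y) + nrm (xs n - x) * nrm y + nrm x * nrm (ys n - y)) \<longlonglongrightarrow> 0"
    using tendsto_add[OF tendsto_add[OF tendsto_mult[OF assms] tendsto_mult_left_zero[OF assms(1), of "nrm y"]]
        tendsto_mult_right_zero[OF assms(2), of "nrm x"]] by simp
  ultimately have "(\<lambda>n. ip (xs n) (ys n) - ip x y) \<longlonglongrightarrow> 0"
    by (rule Lim_null_comparison[OF always_eventually[OF allI]])
  then show ?thesis by (simp add: LIM_zero_iff)
qed

section \<open>Closure in the norm of the fixed decomposition\<close>

definition ncl :: "'a set \<Rightarrow> 'a set" where
  "ncl S = {x. \<forall>e>0. \<exists>s\<in>S. nrm (x - s) < e}"

lemma ncl_seq: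
  assumes "x \<in> ncl S"
  obtains xs where "\<And>n::nat. xs n \<in> S" "(\<lambda>n. nrm (xs n - x)) \<longlonglongrightarrow> 0"
proof -
  have "\<forall>n. \<exists>s\<in>S. nrm (x - s) < inverse (real (Suc n))"
    using assms by (auto simp: ncl_def)
  then obtain xs where xs: "\<And>n. xs n \<in> S" "\<And>n. nrm (x - xs n) < inverse (real (Suc n))"
    by metis
  have "(\<lambda>n. nrm (xs n - x)) \<longlonglongrightarrow> 0"
    using LIMSEQ_inverse_real_of_nat
  proof (rule Lim_null_comparison[rotated])
    show "\<forall>\<^sub>F n in sequentially. norm (nrm (xs n - x)) \<le> inverse (real (Suc n))"
      using xs(2) by (intro always_eventually allI) (simp add: nrm_commute[of _ x] less_imp_le)
  qed
  with xs(1) show ?thesis by (rule that)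
qed

lemma ncl_base: "S \<subseteq> ncl S"
  by (force simp: ncl_def)

lemma ncl_idem: "ncl (ncl S) \<subseteq> ncl S"
proof
  fix x assume x: "x \<in> ncl (ncl S)"
  show "x \<in> ncl S" unfolding ncl_def
  proof (intro CollectI allI impI)
    fix e :: real assume "e > 0"
    then have e2: "e / 2 > 0" by simp
    from x e2 obtain y where y: "y \<in> ncl S" "nrm (x - y) < e / 2"
      unfolding ncl_def[of "ncl S"] by blast
    from y(1) e2 obtain s where s: "s \<in> S" "nrm (y - s) < e / 2"
      unfolding ncl_def by blast
    have "nrm (x - s) < e" using nrm_diff_triangle[of x s y] y s by linarith
    with s show "\<exists>s\<in>S. nrm (x - s) < e" by blast
  qed
qed

lemma ncl_mono: "S \<subseteq> T \<Longrightarrow> ncl S \<subseteq> ncl T"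
  unfolding ncl_def by blast

lemma ncl_subspace: "cv.subspace S \<Longrightarrow> cv.subspace (ncl S)"
proof (rule cv.subspaceI)
  assume S: "cv.subspace S"
  show "0 \<in> ncl S" using ncl_base cv.subspace_0[OF S] by blast
  fix x y c assume x: "x \<in> ncl S"
  { assume y: "y \<in> ncl S"
    show "x + y \<in> ncl S" unfolding ncl_def
    proof (intro CollectI allI impI)
      fix e :: real assume "e > 0"
      then have e2: "e / 2 > 0" by simp
      from x y e2 obtain s t where st: "s \<in> S" "nrm (x - s) < e / 2" "t \<in> S" "nrm (y - t) < e / 2"
        unfolding ncl_def by blast
      have "nrm (x + y - (s + t)) < e"
        using nrm_add[of "x - s" "y - t"] st by (simp add: algebra_simps)
      then show "\<exists>s\<in>S. nrm (x + y - s) < e" using st cv.subspace_add[OF S] by blast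
    qed }
  show "scaleC c x \<in> ncl S" unfolding ncl_def
  proof (intro CollectI allI impI)
    fix e :: real assume "e > 0"
    then have e2: "e / (cmod c + 1) > 0" by (simp add: add_nonneg_pos)
    from x e2 obtain s where s: "s \<in> S" "nrm (x - s) < e / (cmod c + 1)"
      unfolding ncl_def by blast
    have "nrm (scaleC c x - scaleC c s) = cmod c * nrm (x - s)"
      by (simp add: nrm_scale[symmetric] cv.scale_right_diff_distrib)
    also have "\<dots> \<le> (cmod c + 1) * nrm (x - s)" by (simp add: algebra_simps)
    also have "\<dots> < e" using s(2) by (simp add: pos_less_divide_eq add_nonneg_pos mult.commute)
    finally show "\<exists>s\<in>S. nrm (scaleC c x - s) < e" using s(1) cv.subspace_scale[OF S] by blast
  qed
qed

text \<open>\<open>pclosure\<close> asks for approximation in the norm of every fundamental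
  decomposition, and the fixed one is among them. Together with \<open>pclosure_base\<close> this is
  the interface to \<open>pclosure\<close>.\<close>

lemma pclosure_ncl: "pclosure ip S \<subseteq> ncl S"
proof
  fix x assume "x \<in> pclosure ip S"
  with dec have "\<exists>xs. (\<forall>k. xs k \<in> S) \<and> (\<lambda>k. nrm (xs k - x)) \<longlonglongrightarrow> 0"
    unfolding pclosure_def by blast
  then obtain xs where xs: "\<And>k. xs k \<in> S" "(\<lambda>k. nrm (xs k - x)) \<longlonglongrightarrow> 0"
    by blast
  show "x \<in> ncl S" unfolding ncl_def
  proof (intro CollectI allI impI)
    fix e :: real assume "e > 0"
    with xs(2) have "\<forall>\<^sub>F k in sequentially. nrm (xs k - x) < e" by (rule order_tendstoD)
    then obtain k where "nrm (xs k - x) < e" by (auto simp: eventually_sequentially)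
    then show "\<exists>s\<in>S. nrm (x - s) < e" using xs(1)[of k] by (auto simp: nrm_commute[of x])
  qed
qed

lemma pclosure_base: "S \<subseteq> pclosure ip S"
proof
  fix x assume "x \<in> S"
  moreover have "jnorm ip P' N' (x - x) = 0" if "adm_decomp ip P' N'" for P' N'
  proof -
    interpret d: pontryagin_decomp ip P' N' by unfold_locales (rule that)
    show ?thesis by simp
  qed
  ultimately show "x \<in> pclosure ip S"
    unfolding pclosure_def by (intro CollectI allI impI exI[of _ "\<lambda>_. x"]) auto
qed

lemma orth_dense:
  assumes "\<And>s. s \<in> S \<Longrightarrow> ip x s = 0" "y \<in> ncl S" shows "ip x y = 0"
proof -
  obtain ys where ys: "\<And>n. ys n \<in> S" "(\<lambda>n. nrm (ys n - y)) \<longlonglongrightarrow> 0"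
    using ncl_seq[OF assms(2)] by blast
  have "(\<lambda>n. ip x (ys n)) \<longlonglongrightarrow> ip x y" by (rule ip_tendsto[OF _ ys(2)]) simp
  then have "(\<lambda>n. 0) \<longlonglongrightarrow> ip x y" using assms(1)[OF ys(1)] by simp
  then show ?thesis using LIMSEQ_unique tendsto_const by metis
qed

text \<open>A vector of the finitely generated part \<open>N\<close> is recovered from its products
  with a system normalised by \<open>gram_schmidt\<close>. As the \<open>e i\<close> lie in
  \<open>N\<close>, these products do not see \<open>pp x\<close>, so the negative component of any
  \<open>x\<close> is determined by the finitely many scalars \<open>ip x (e i)\<close>.\<close>

lemma N_basis:
  "\<exists>(d::nat) e. (\<forall>x. nn x = - (\<Sum>i<d. scaleC (ip x (e i)) (e i)))
    \<and> (\<forall>x. - Re (ip (nn x) (nn x)) = (\<Sum>i<d. (cmod (ip x (e i)))\<^sup>2))"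
proof -
  obtain vs where vs: "N = cv.span (set vs)" using N_fin by blast
  define d where "d = length vs"
  define f where "f = (!) vs"
  have fN: "f k \<in> N" if "k < d" for k
    using that by (auto simp: vs f_def d_def intro: cv.span_base)
  have cN: "(\<Sum>k<d. scaleC (c k) (f k)) \<in> N" for c
    using fN N_sub by (auto intro!: cv.subspace_sum cv.subspace_scale)
  have "Re (ip (\<Sum>k<d. scaleC (c k) (f k)) (\<Sum>k<d. scaleC (c k) (f k))) < 0
      \<or> (\<Sum>k<d. scaleC (c k) (f k)) = 0" for c
    using N_neg[OF cN] by blast
  from gram_schmidt[OF this] obtain e where
    "\<forall>i<d. \<exists>c. c i \<noteq> 0 \<and> e i = (\<Sum>k<d. scaleC (c k) (f k))"
    "\<forall>i<d. f i = - (\<Sum>j<d. scaleC (ip (f i) (e j)) (e j))"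
    by (elim exE conjE)
  then have e: "\<And>i. i < d \<Longrightarrow> \<exists>c. c i \<noteq> 0 \<and> e i = (\<Sum>k<d. scaleC (c k) (f k))"
       "\<And>i. i < d \<Longrightarrow> f i = - (\<Sum>j<d. scaleC (ip (f i) (e j)) (e j))"
    by simp_all
  have eN: "e i \<in> N" if "i < d" for i using e(1)[OF that] cN by auto
  define R where "R x = - (\<Sum>j<d. scaleC (ip x (e j)) (e j))" for x
  \<comment> \<open>The fixed vectors of \<open>R\<close> form a subspace containing the generators
    of \<open>N\<close>, hence all of \<open>N\<close>.\<close>
  define S where "S = {x. R x = x}"
  have R: "R (x + y) = R x + R y" "R (scaleC c x) = scaleC c (R x)" "R 0 = 0" for x y c
    by (simp_all add: R_def ip_simps cv.scale_left_distrib sum.distrib cv.scale_sum_right)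
  have "cv.subspace S"
    by (rule cv.subspaceI) (simp_all add: S_def R)
  moreover have "set vs \<subseteq> S"
    using e(2) by (auto simp: S_def R_def f_def d_def in_set_conv_nth)
  ultimately have "N \<subseteq> S" unfolding vs by (intro cv.span_minimal) auto
  have ipe: "ip (nn x) (e i) = ip x (e i)" if "i < d" for x i
  proof -
    have "ip x (e i) = ip (pp x + nn x) (e i)" by (simp add: pp_nn)
    then show ?thesis using PN_orth[OF pp_in eN[OF that]] by (simp add: ip_simps)
  qed
  have nn: "nn x = - (\<Sum>i<d. scaleC (ip x (e i)) (e i))" for x
  proof -
    have "nn x \<in> S" using nn_in \<open>N \<subseteq> S\<close> by auto
    then have "nn x = R (nn x)" by (simp add: S_def)
    also have "\<dots> = - (\<Sum>i<d. scaleC (ip x (e i)) (e i))"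
      unfolding R_def by (intro arg_cong[of _ _ uminus] sum.cong) (simp_all add: ipe)
    finally show ?thesis .
  qed
  have "- Re (ip (nn x) (nn x)) = (\<Sum>i<d. (cmod (ip x (e i)))\<^sup>2)" for x
  proof -
    have "ip (nn x) (nn x) = - (\<Sum>i<d. cnj (ip x (e i)) * ip (nn x) (e i))"
      by (subst (2) nn) (simp add: ip_simps sum_right)
    also have "\<dots> = - complex_of_real (\<Sum>i<d. (cmod (ip x (e i)))\<^sup>2)"
      unfolding of_real_sum complex_norm_square[abs_def]
      by (auto simp: ipe mult.commute intro!: sum.cong)
    finally show ?thesis by simp
  qed
  with nn show ?thesis by (intro exI[of _ d] exI[of _ e]) simp
qed

end

section \<open>Convergence criteria\<close>

context pontryagin_decomp begin

text \<open>On vectors with small self product the norm is controlled by finitely many functionals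
  from any dense set, because the negative component is finite-dimensional.\<close>
lemma nrm_estimate:
  assumes dense: "ncl T = UNIV"
  shows "\<exists>(k::nat) t. (\<forall>i. t i \<in> T) \<and>
    (\<forall>x. nrm x \<le> 4 * ((\<Sum>i<k. cmod (ip x (t i))) + sqrt (cmod (ip x x))))"
proof -
  obtain k :: nat and e where
    nn2: "\<forall>x. - Re (ip (nn x) (nn x)) = (\<Sum>i<k. (cmod (ip x (e i)))\<^sup>2)"
    using N_basis by (elim exE conjE)
  \<comment> \<open>Replacing the \<open>k\<close> vectors \<open>e i\<close> by elements of
    \<open>T\<close> costs at most \<open>nrm x / 4\<close> in their sum, hence half of
    \<open>nrm x\<close> in the bound \<open>r + 2 * q\<close>; this is absorbed on the
    left.\<close>
  define \<delta> where "\<delta> = 1 / (4 * (real k + 1))"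
  have \<delta>: "\<delta> > 0" "real k * \<delta> \<le> 1 / 4" by (auto simp: \<delta>_def field_simps)
  have "\<forall>i. \<exists>t. t \<in> T \<and> nrm (e i - t) < \<delta>" using dense \<delta>(1) unfolding ncl_def by blast
  from choice[OF this] obtain t where t: "\<And>i. t i \<in> T" "\<And>i. nrm (e i - t i) < \<delta>"
    by blast
  have "nrm x \<le> 4 * ((\<Sum>i<k. cmod (ip x (t i))) + sqrt (cmod (ip x x)))" for x
  proof -
    define q r s where "q = (\<Sum>i<k. cmod (ip x (e i)))" and "r = sqrt (cmod (ip x x))"
      and "s = (\<Sum>i<k. cmod (ip x (t i)))"
    have nonneg: "q \<ge> 0" "r \<ge> 0" "s \<ge> 0" by (auto simp: q_def r_def s_def sum_nonneg)
    have "L2_set (\<lambda>i. cmod (ip x (e i))) {..<k} \<le> q" unfolding q_def by (rule L2_set_le_sum) simp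
    then have "(\<Sum>i<k. (cmod (ip x (e i)))\<^sup>2) \<le> q\<^sup>2"
      unfolding L2_set_def by (rule sqrt_le_D)
    \<comment> \<open>Trading the positive component for the self product leaves only the negative
      component, which the \<open>e i\<close> detect.\<close>
    moreover have "(nrm x)\<^sup>2 = Re (ip x x) - 2 * Re (ip (nn x) (nn x))"
      unfolding nrm_sq by (subst (3) ip_pp_nn) simp
    moreover have "Re (ip x x) \<le> r\<^sup>2" by (simp add: r_def complex_Re_le_cmod)
    ultimately have "(nrm x)\<^sup>2 \<le> r\<^sup>2 + 2 * q\<^sup>2" using nn2[rule_format, of x] by linarith
    also have "\<dots> \<le> (r + 2 * q)\<^sup>2"
      using nonneg by (simp add: power2_sum)
    finally have 1: "nrm x \<le> r + 2 * q" using nonneg by (simp add: power2_le_iff_abs_le)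
    have "q \<le> (\<Sum>i<k. cmod (ip x (t i)) + nrm x * \<delta>)"
      unfolding q_def
    proof (rule sum_mono)
      fix i
      have "cmod (ip x (e i)) = cmod (ip x (t i) + ip x (e i - t i))" by (simp add: ip_simps)
      also have "\<dots> \<le> cmod (ip x (t i)) + cmod (ip x (e i - t i))" by (rule norm_triangle_ineq)
      also have "cmod (ip x (e i - t i)) \<le> nrm x * nrm (e i - t i)" by (rule ip_bound)
      also have "\<dots> \<le> nrm x * \<delta>" using t(2)[of i] by (intro mult_left_mono) auto
      finally show "cmod (ip x (e i)) \<le> cmod (ip x (t i)) + nrm x * \<delta>" by simp
    qed
    also have "\<dots> = s + nrm x * (real k * \<delta>)" by (simp add: s_def sum.distrib)
    also have "\<dots> \<le> s + nrm x * (1 / 4)" using \<delta>(2) by (intro add_left_mono mult_left_mono) auto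
    finally have "q \<le> s + nrm x / 4" by simp
    with 1 nonneg have "nrm x \<le> 4 * (s + r)" by simp
    then show ?thesis by (simp add: r_def s_def)
  qed
  with t(1) show ?thesis by (intro exI[of _ k] exI[of _ t]) simp
qed

text \<open>Stated as a limit along the product filter, so that the limit rules apply to double
  sequences without choosing indices.\<close>

abbreviation cauchy_seq :: "(nat \<Rightarrow> 'a) \<Rightarrow> bool" where
  "cauchy_seq xs \<equiv> ((\<lambda>p. nrm (xs (fst p) - xs (snd p))) \<longlongrightarrow> 0) (sequentially \<times>\<^sub>F sequentially)"

text \<open>The positive components converge because \<open>P\<close> is complete. The negative
  components are determined by finitely many scalar sequences \<open>ip (xs n) (e i)\<close>, which
  are Cauchy by \<open>ip_bound\<close>.\<close>

lemma complete:
  assumes xs: "cauchy_seq xs"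
  shows "\<exists>x. (\<lambda>n. nrm (xs n - x)) \<longlonglongrightarrow> 0"
proof -
  have ev: "\<exists>M. \<forall>m\<ge>M. \<forall>n\<ge>M. nrm (xs m - xs n) < \<epsilon>" if "\<epsilon> > 0" for \<epsilon>
    using order_tendstoD(2)[OF xs that] by (auto simp: eventually_prod_sequentially)
  have pp_le: "sqrt (Re (ip (pp x) (pp x))) \<le> nrm x" for x
    using nn_nonpos[of x] by (simp add: nrm_hp hp_def)
  have pp_le': "sqrt (Re (ip (pp x - pp y) (pp x - pp y))) \<le> nrm (x - y)" for x y
    using pp_le[of "x - y"] by (simp add: pp_diff)
  have "\<forall>e>0. \<exists>M. \<forall>m\<ge>M. \<forall>n\<ge>M. sqrt (Re (ip (pp (xs m) - pp (xs n)) (pp (xs m) - pp (xs n)))) < e"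
  proof (intro allI impI)
    fix e :: real assume "e > 0"
    from ev[OF this] obtain M where "\<forall>m\<ge>M. \<forall>n\<ge>M. nrm (xs m - xs n) < e" ..
    then show "\<exists>M. \<forall>m\<ge>M. \<forall>n\<ge>M. sqrt (Re (ip (pp (xs m) - pp (xs n)) (pp (xs m) - pp (xs n)))) < e"
      by (intro exI[of _ M] allI impI le_less_trans[OF pp_le']) simp
  qed
  then obtain p where p: "p \<in> P" "(\<lambda>k. sqrt (Re (ip (pp (xs k) - p) (pp (xs k) - p)))) \<longlonglongrightarrow> 0"
    using P_complete[unfolded ncomplete_def, rule_format, of "\<lambda>k. pp (xs k)"] pp_in by auto
  obtain d :: nat and e where nn: "\<forall>x. nn x = - (\<Sum>i<d. scaleC (ip x (e i)) (e i))"
    using N_basis by (elim exE conjE)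
  have "\<exists>c. (\<lambda>n. ip (xs n) (e i)) \<longlonglongrightarrow> c" for i :: nat
  proof -
    have "Cauchy (\<lambda>n. ip (xs n) (e i))" unfolding Cauchy_def
    proof (intro allI impI)
      fix \<epsilon> :: real assume "\<epsilon> > 0"
      then have "\<epsilon> / (nrm (e i) + 1) > 0" by (simp add: add_nonneg_pos)
      from ev[OF this] obtain M where M: "\<And>m n. m \<ge> M \<Longrightarrow> n \<ge> M \<Longrightarrow> nrm (xs m - xs n) < \<epsilon> / (nrm (e i) + 1)"
        by blast
      have "dist (ip (xs m) (e i)) (ip (xs n) (e i)) < \<epsilon>" if "m \<ge> M" "n \<ge> M" for m n
      proof -
        have "dist (ip (xs m) (e i)) (ip (xs n) (e i)) = cmod (ip (xs m - xs n) (e i))"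
          by (simp add: dist_norm ip_simps)
        also have "\<dots> \<le> nrm (xs m - xs n) * nrm (e i)" by (rule ip_bound)
        also have "\<dots> \<le> nrm (xs m - xs n) * (nrm (e i) + 1)" by (intro mult_left_mono) auto
        also have "\<dots> < \<epsilon>" using M[OF that] by (simp add: pos_less_divide_eq add_nonneg_pos)
        finally show ?thesis .
      qed
      then show "\<exists>M. \<forall>m\<ge>M. \<forall>n\<ge>M. dist (ip (xs m) (e i)) (ip (xs n) (e i)) < \<epsilon>" by blast
    qed
    then show ?thesis by (simp add: Cauchy_convergent_iff convergent_def)
  qed
  then obtain c where c: "\<And>i. (\<lambda>n. ip (xs n) (e i)) \<longlonglongrightarrow> c i" by metis
  \<comment> \<open>The minus sign is that of the expansion of \<open>nn\<close> in the
    \<open>e i\<close>.\<close>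
  define x where "x = p - (\<Sum>i<d. scaleC (c i) (e i))"
  have bound: "nrm (xs n - x) \<le> sqrt (Re (ip (pp (xs n) - p) (pp (xs n) - p)))
      + (\<Sum>i<d. cmod (ip (xs n) (e i) - c i) * nrm (e i))" for n
  proof -
    have "xs n - x = (pp (xs n) - p) + (nn (xs n) + (\<Sum>i<d. scaleC (c i) (e i)))"
      using pp_nn[of "xs n"] by (simp add: x_def algebra_simps)
    also have "nn (xs n) + (\<Sum>i<d. scaleC (c i) (e i)) = (\<Sum>i<d. scaleC (c i - ip (xs n) (e i)) (e i))"
      by (simp add: nn[rule_format] cv.scale_left_diff_distrib sum_subtractf)
    finally have "nrm (xs n - x) \<le> nrm (pp (xs n) - p) + nrm (\<Sum>i<d. scaleC (c i - ip (xs n) (e i)) (e i))"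
      using nrm_add by simp
    also have "nrm (\<Sum>i<d. scaleC (c i - ip (xs n) (e i)) (e i)) \<le> (\<Sum>i<d. cmod (ip (xs n) (e i) - c i) * nrm (e i))"
      by (rule order_trans[OF nrm_sum]) (simp add: nrm_scale norm_minus_commute)
    also have "nrm (pp (xs n) - p) = sqrt (Re (ip (pp (xs n) - p) (pp (xs n) - p)))"
    proof -
      have "pp (pp (xs n) - p) = pp (xs n) - p"
        by (intro pp_P cv.subspace_diff[OF P_sub] pp_in p(1))
      then show ?thesis by (simp add: nrm_hp hp_def nn_def)
    qed
    finally show ?thesis by simp
  qed
  have "(\<lambda>n. \<Sum>i<d. cmod (ip (xs n) (e i) - c i) * nrm (e i)) \<longlonglongrightarrow> 0"
    by (intro tendsto_null_sum tendsto_mult_left_zero tendsto_norm_zero LIM_zero c)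
  from tendsto_add_zero[OF p(2) this]
  have "(\<lambda>n. nrm (xs n - x)) \<longlonglongrightarrow> 0"
    by (rule Lim_null_comparison[OF always_eventually[OF allI], rotated]) (simp add: bound)
  then show ?thesis by blast
qed

text \<open>Applied to differences, \<open>nrm_estimate\<close> bounds their norms by finitely many
  products with elements of \<open>T\<close> and the root of the self product. All of these tend to
  0, so the sequence is Cauchy.\<close>

lemma weak_complete:
  assumes dense: "ncl T = UNIV"
    and weak: "\<And>t. t \<in> T \<Longrightarrow> convergent (\<lambda>n. ip (xs n) t)"
    and self: "((\<lambda>p. ip (xs (fst p) - xs (snd p)) (xs (fst p) - xs (snd p))) \<longlongrightarrow> 0)
      (sequentially \<times>\<^sub>F sequentially)"
  shows "\<exists>x. (\<lambda>n. nrm (xs n - x)) \<longlonglongrightarrow> 0"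
proof (rule complete)
  obtain k :: nat and t where t: "\<forall>i. t i \<in> T"
    and est: "\<forall>x. nrm x \<le> 4 * ((\<Sum>i<k. cmod (ip x (t i))) + sqrt (cmod (ip x x)))"
    using nrm_estimate[OF dense] by (elim exE conjE)
  let ?d = "\<lambda>p. xs (fst p) - xs (snd p)"
  have "((\<lambda>p. ip (?d p) (t i)) \<longlongrightarrow> 0) (sequentially \<times>\<^sub>F sequentially)" for i
  proof -
    obtain l where l: "(\<lambda>n. ip (xs n) (t i)) \<longlonglongrightarrow> l"
      using weak[OF t[rule_format, of i]] by (auto simp: convergent_def)
    have "((\<lambda>p. ip (xs (fst p)) (t i) - ip (xs (snd p)) (t i)) \<longlongrightarrow> l - l) (sequentially \<times>\<^sub>F sequentially)"
      by (intro tendsto_diff filterlim_compose[OF l] filterlim_fst filterlim_snd)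
    then show ?thesis by (simp add: ip_simps)
  qed
  then have "((\<lambda>p. \<Sum>i<k. cmod (ip (?d p) (t i))) \<longlongrightarrow> 0) (sequentially \<times>\<^sub>F sequentially)"
    by (intro tendsto_null_sum tendsto_norm_zero)
  moreover have "((\<lambda>p. sqrt (cmod (ip (?d p) (?d p)))) \<longlongrightarrow> 0) (sequentially \<times>\<^sub>F sequentially)"
    using tendsto_real_sqrt[OF tendsto_norm_zero[OF self]] by simp
  ultimately have lim: "((\<lambda>p. 4 * ((\<Sum>i<k. cmod (ip (?d p) (t i))) + sqrt (cmod (ip (?d p) (?d p))))) \<longlongrightarrow> 0)
      (sequentially \<times>\<^sub>F sequentially)"
    using tendsto_mult_right_zero[OF tendsto_add_zero] by blast
  show "cauchy_seq xs"
    using est[rule_format] by (intro Lim_null_comparison[OF always_eventually[OF allI] lim]) simp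
qed

text \<open>Supplies the last premise of \<open>weak_complete\<close>: self products of differences
  are carried by an isometry from a convergent sequence to its partner, whose convergence is still
  open.\<close>

lemma self_tendsto_0:
  assumes "(\<lambda>n. nrm (xs n - x)) \<longlonglongrightarrow> 0"
  shows "((\<lambda>p. ip (xs (fst p) - xs (snd p)) (xs (fst p) - xs (snd p))) \<longlongrightarrow> 0)
      (sequentially \<times>\<^sub>F sequentially)"
proof (rule Lim_null_comparison[OF always_eventually[OF allI]])
  fix p :: "nat \<times> nat"
  let ?a = "nrm (xs (fst p) - x)" and ?b = "nrm (xs (snd p) - x)"
  have "nrm (xs (fst p) - xs (snd p)) \<le> ?a + ?b"
    using nrm_diff_triangle[of "xs (fst p)" "xs (snd p)" x] nrm_commute[of x] by simp
  then have "nrm (xs (fst p) - xs (snd p)) * nrm (xs (fst p) - xs (snd p)) \<le> (?a + ?b) * (?a + ?b)"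
    by (intro mult_mono) auto
  then show "cmod (ip (xs (fst p) - xs (snd p)) (xs (fst p) - xs (snd p))) \<le> (?a + ?b) * (?a + ?b)"
    by (rule order_trans[OF ip_bound])
next
  have "((\<lambda>p. (nrm (xs (fst p) - x) + nrm (xs (snd p) - x)) * (nrm (xs (fst p) - x) + nrm (xs (snd p) - x)))
     \<longlongrightarrow> (0 + 0) * (0 + 0)) (sequentially \<times>\<^sub>F sequentially)"
    by (intro tendsto_mult tendsto_add filterlim_compose[OF assms] filterlim_fst filterlim_snd)
  then show "((\<lambda>p. (nrm (xs (fst p) - x) + nrm (xs (snd p) - x)) * (nrm (xs (fst p) - x) + nrm (xs (snd p) - x)))
     \<longlongrightarrow> 0) (sequentially \<times>\<^sub>F sequentially)" by simp
qed

end

subsection \<open>Unitary extension of isometric relations\<close>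

text \<open>\<open>S\<close> stands for \<open>L1\<close> and \<open>R\<close> for its complement
  built from \<open>L0\<close>, \<open>F\<close> and \<open>L2\<close>. The domain of
  \<open>W\<close> need not lie in \<open>S\<close>; the last assumption says that it deviates from
  \<open>S\<close> only by vectors orthogonal to the whole domain, which \<open>W\<close> therefore
  cannot distinguish from 0.\<close>

locale isometric_relation =
  X: pontryagin_decomp ipx PX NX + Y: pontryagin_decomp ipy PY NY
  for ipx :: "'x::cvec \<Rightarrow> 'x \<Rightarrow> complex" and PX NX
    and ipy :: "'y::cvec \<Rightarrow> 'y \<Rightarrow> complex" and PY NY +
  fixes W :: "('x \<times> 'y) set" and S R :: "'x set"
  assumes W_sub: "cv.subspace W"
    and W_iso: "\<And>v w. v \<in> W \<Longrightarrow> w \<in> W \<Longrightarrow> ipx (fst v) (fst w) = ipy (snd v) (snd w)"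
    and ran_dense: "Y.ncl (snd ` W) = UNIV"
    and S_sub: "cv.subspace S"
    and SR_span: "\<And>x. \<exists>s\<in>S. \<exists>r\<in>R. x = s + r"
    and SR_orth: "\<And>s r. s \<in> S \<Longrightarrow> r \<in> R \<Longrightarrow> ipx s r = 0"
    and S_dense: "S \<subseteq> X.ncl (fst ` W)"
    and dom_decomp: "\<And>x. x \<in> fst ` W \<Longrightarrow> \<exists>s\<in>S. \<exists>r\<in>R. x = s + r \<and> (\<forall>v\<in>W. ipx (fst v) r = 0)"
begin

text \<open>The extension is described by its products with \<open>W\<close> and not as a limit, so
  no independence of approximating sequences has to be shown: uniqueness follows from density and
  nondegeneracy, and linearity is immediate.\<close>

definition U :: "'x \<Rightarrow> 'y \<Rightarrow> bool" where
  "U s y \<longleftrightarrow> s \<in> S \<and> (\<forall>w\<in>W. ipx s (fst w) = ipy y (snd w))"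

lemma W_diff: "v \<in> W \<Longrightarrow> w \<in> W \<Longrightarrow> (fst v - fst w, snd v - snd w) \<in> W"
  using cv.subspace_diff[OF W_sub, of v w] by (simp add: minus_prod_def)

lemma U_unique_right: "U s y \<Longrightarrow> U s y' \<Longrightarrow> y = y'"
proof -
  assume "U s y" "U s y'"
  then have "ipy (y - y') t = 0" if "t \<in> snd ` W" for t
    using that by (auto simp: U_def Y.ip_simps)
  then have "ipy (y - y') t = 0" for t
    using Y.orth_dense[of "snd ` W"] ran_dense by blast
  then have "y - y' = 0" by (rule Y.nondeg)
  then show ?thesis by simp
qed

text \<open>The difference is orthogonal to the domain, hence to \<open>S\<close>; lying in
  \<open>S\<close>, it is also orthogonal to \<open>R\<close>, and \<open>S\<close> and
  \<open>R\<close> together span the space.\<close>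

lemma U_unique_left: "U s y \<Longrightarrow> U s' y \<Longrightarrow> s = s'"
proof -
  assume u: "U s y" "U s' y"
  then have sS: "s - s' \<in> S" using cv.subspace_diff[OF S_sub] by (simp add: U_def)
  have "ipx (s - s') t = 0" if "t \<in> fst ` W" for t
    using that u by (auto simp: U_def X.ip_simps) (metis fst_conv snd_conv)
  then have "ipx (s - s') t = 0" if "t \<in> S" for t
    using X.orth_dense[of "fst ` W"] S_dense that by blast
  then have "ipx (s - s') x = 0" for x
    using SR_span[of x] SR_orth[OF sS] by (auto simp: X.ip_simps)
  then have "s - s' = 0" by (rule X.nondeg)
  then show ?thesis by simp
qed

text \<open>For a sequence in the domain converging to \<open>s\<close>, isometry converts the
  products of the images with the range, and the self products of their differences, into quantities
  on the convergent side; \<open>weak_complete\<close> then gives the limit. The sequence is kept in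
  the conclusion for use in \<open>U_iso\<close>.\<close>

lemma U_approx:
  assumes "s \<in> S"
  obtains w y where "\<And>n::nat. w n \<in> W" "(\<lambda>n. X.nrm (fst (w n) - s)) \<longlonglongrightarrow> 0"
    "(\<lambda>n. Y.nrm (snd (w n) - y)) \<longlonglongrightarrow> 0" "U s y"
proof -
  have "s \<in> X.ncl (fst ` W)" using assms S_dense by auto
  then obtain xs where xs: "\<And>n. xs n \<in> fst ` W" "(\<lambda>n. X.nrm (xs n - s)) \<longlonglongrightarrow> 0"
    using X.ncl_seq by blast
  then have "\<forall>n. \<exists>w. w \<in> W \<and> xs n = fst w" by blast
  then obtain w where w: "\<And>n. w n \<in> W" "\<And>n. xs n = fst (w n)" by metis
  have lim: "(\<lambda>n. ipy (snd (w n)) (snd v)) \<longlonglongrightarrow> ipx s (fst v)" if "v \<in> W" for v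
    unfolding W_iso[OF w(1) that, symmetric] w(2)[symmetric]
    by (rule X.ip_tendsto[OF xs(2)]) simp
  have "\<exists>y. (\<lambda>n. Y.nrm (snd (w n) - y)) \<longlonglongrightarrow> 0"
  proof (rule Y.weak_complete[OF ran_dense])
    show "convergent (\<lambda>n. ipy (snd (w n)) t)" if "t \<in> snd ` W" for t
      using that lim by (auto simp: convergent_def)
    have "ipy (snd (w m) - snd (w n)) (snd (w m) - snd (w n)) = ipx (xs m - xs n) (xs m - xs n)" for m n
      using W_iso[OF W_diff W_diff, OF w(1) w(1) w(1) w(1), of m n m n] by (simp add: w(2))
    then show "((\<lambda>p. ipy (snd (w (fst p)) - snd (w (snd p))) (snd (w (fst p)) - snd (w (snd p)))) \<longlongrightarrow> 0)
        (sequentially \<times>\<^sub>F sequentially)"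
      using X.self_tendsto_0[OF xs(2)] by simp
  qed
  then obtain y where y: "(\<lambda>n. Y.nrm (snd (w n) - y)) \<longlonglongrightarrow> 0" by blast
  have "ipx s (fst v) = ipy y (snd v)" if "v \<in> W" for v
  proof -
    have "(\<lambda>n. ipy (snd (w n)) (snd v)) \<longlonglongrightarrow> ipy y (snd v)"
      by (rule Y.ip_tendsto[OF y]) simp
    with lim[OF that] show ?thesis by (rule LIMSEQ_unique)
  qed
  then have "U s y" using assms by (simp add: U_def)
  with w xs(2) y show ?thesis using that[of w y] by simp
qed

text \<open>Approximating \<open>s'\<close> from the domain reduces the claim to the products with
  \<open>W\<close> that define \<open>U s y\<close>.\<close>

lemma U_iso: "U s y \<Longrightarrow> U s' y' \<Longrightarrow> ipx s s' = ipy y y'"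
proof -
  assume u: "U s y" "U s' y'"
  then have "s' \<in> S" by (simp add: U_def)
  from U_approx[OF this] obtain w z where w: "\<And>n. w n \<in> W" "(\<lambda>n. X.nrm (fst (w n) - s')) \<longlonglongrightarrow> 0"
    "(\<lambda>n. Y.nrm (snd (w n) - z)) \<longlonglongrightarrow> 0" "U s' z" by blast
  have "z = y'" using w(4) u(2) by (rule U_unique_right)
  have "(\<lambda>n. ipx s (fst (w n))) \<longlonglongrightarrow> ipx s s'"
    by (rule X.ip_tendsto[OF _ w(2)]) simp
  moreover have "ipx s (fst (w n)) = ipy y (snd (w n))" for n
    using u(1) w(1) by (simp add: U_def)
  ultimately have "(\<lambda>n. ipy y (snd (w n))) \<longlonglongrightarrow> ipx s s'" by simp
  moreover have "(\<lambda>n. ipy y (snd (w n))) \<longlonglongrightarrow> ipy y y'"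
    using w(3) \<open>z = y'\<close> by (intro Y.ip_tendsto) simp_all
  ultimately show ?thesis by (rule LIMSEQ_unique)
qed

lemma SR_nondeg:
  assumes "\<And>s. s \<in> S \<Longrightarrow> ipx b s = 0" "\<And>r. r \<in> R \<Longrightarrow> ipx b r = 0" shows "b = 0"
proof (rule X.nondeg)
  fix x
  obtain s r where "s \<in> S" "r \<in> R" "x = s + r" using SR_span by blast
  then show "ipx b x = 0" using assms by (simp add: X.ip_simps)
qed

text \<open>A test set for \<open>weak_complete\<close> suited to sequences in \<open>S\<close>:
  their products with \<open>R\<close> vanish, and those with the domain can be computed through
  \<open>W\<close>.\<close>

lemma S_R_dense: "X.ncl {x + r | x r. x \<in> fst ` W \<and> r \<in> R} = UNIV"
proof -
  have "x \<in> X.ncl {x + r | x r. x \<in> fst ` W \<and> r \<in> R}" for x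
    unfolding X.ncl_def
  proof (intro CollectI allI impI)
    fix e :: real assume "e > 0"
    obtain s r where sr: "s \<in> S" "r \<in> R" "x = s + r" using SR_span by blast
    with S_dense \<open>e > 0\<close> obtain t where "t \<in> fst ` W" "X.nrm (s - t) < e"
      unfolding X.ncl_def by blast
    with sr have "t + r \<in> {x + r | x r. x \<in> fst ` W \<and> r \<in> R}" "X.nrm (x - (t + r)) < e" by auto
    then show "\<exists>s\<in>{x + r | x r. x \<in> fst ` W \<and> r \<in> R}. X.nrm (x - s) < e" by blast
  qed
  then show ?thesis by blast
qed

text \<open>For elements of the range converging to \<open>y\<close>, the matching first components
  need not converge, since their \<open>R\<close> parts are not controlled by any product with the
  domain. Dropping these parts changes neither the products with the domain nor the self products of
  differences, and the remaining \<open>S\<close> parts do converge.\<close>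

lemma U_surj: "\<exists>s. U s y"
proof -
  have "y \<in> Y.ncl (snd ` W)" using ran_dense by auto
  then obtain ys where ys: "\<And>n. ys n \<in> snd ` W" "(\<lambda>n. Y.nrm (ys n - y)) \<longlonglongrightarrow> 0"
    using Y.ncl_seq by blast
  then have "\<forall>n. \<exists>w. w \<in> W \<and> ys n = snd w" by blast
  then obtain w where w: "\<And>n. w n \<in> W" "\<And>n. ys n = snd (w n)" by metis
  have "\<forall>n. \<exists>s r. s \<in> S \<and> r \<in> R \<and> fst (w n) = s + r \<and> (\<forall>v\<in>W. ipx (fst v) r = 0)"
    using dom_decomp w(1) by blast
  then obtain s r where s: "\<And>n. s n \<in> S" and r: "\<And>n. r n \<in> R" "\<And>n v. v \<in> W \<Longrightarrow> ipx (fst v) (r n) = 0"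
    and sr: "\<And>n. fst (w n) = s n + r n" by metis
  have s_eq: "s n = fst (w n) - r n" for n by (simp add: sr)
  have sW: "ipx (s n) (fst v) = ipy (ys n) (snd v)" if "v \<in> W" for n v
    using r(2)[OF that, of n] X.eq_zero_sym[of "r n" "fst v"] W_iso[OF w(1) that, of n]
    by (simp add: s_eq X.ip_simps w(2))
  have sself: "ipx (s m - s n) (s m - s n) = ipy (ys m - ys n) (ys m - ys n)" for m n
  proof -
    have "ipx (s m - s n) (s m - s n) = ipx (s m - s n) (fst (w m) - fst (w n))"
      using SR_orth[OF s r(1)] by (simp add: sr X.ip_simps)
    also have "\<dots> = ipy (ys m - ys n) (ys m - ys n)"
      using sW[OF w(1)] by (simp add: X.ip_simps Y.ip_simps w(2))
    finally show ?thesis .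
  qed
  have lim: "(\<lambda>n. ipx (s n) (fst v)) \<longlonglongrightarrow> ipy y (snd v)" if "v \<in> W" for v
    unfolding sW[OF that] by (rule Y.ip_tendsto[OF ys(2)]) simp
  have "\<exists>x. (\<lambda>n. X.nrm (s n - x)) \<longlonglongrightarrow> 0"
  proof (rule X.weak_complete[OF S_R_dense])
    show "convergent (\<lambda>n. ipx (s n) t)" if "t \<in> {x + r | x r. x \<in> fst ` W \<and> r \<in> R}" for t
      using that lim SR_orth[OF s] by (fastforce simp: convergent_def X.ip_simps)
    show "((\<lambda>p. ipx (s (fst p) - s (snd p)) (s (fst p) - s (snd p))) \<longlongrightarrow> 0) (sequentially \<times>\<^sub>F sequentially)"
      unfolding sself by (rule Y.self_tendsto_0[OF ys(2)])
  qed
  then obtain x where x: "(\<lambda>n. X.nrm (s n - x)) \<longlonglongrightarrow> 0" by blast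
  obtain a b where ab: "a \<in> S" "b \<in> R" "x = a + b" using SR_span by blast
  \<comment> \<open>This places the limit in \<open>S\<close>: its \<open>R\<close> part is
    orthogonal to \<open>S\<close>, and also to \<open>R\<close> because the sequence is.\<close>
  have "b = 0"
  proof (rule SR_nondeg)
    show "ipx b t = 0" if "t \<in> S" for t
      using SR_orth[OF that ab(2)] X.eq_zero_sym by blast
    fix t assume t: "t \<in> R"
    have "(\<lambda>n. ipx (s n) t) \<longlonglongrightarrow> ipx x t" by (rule X.ip_tendsto[OF x]) simp
    then have "ipx x t = 0" using SR_orth[OF s t] LIMSEQ_unique[OF _ tendsto_const] by simp
    then show "ipx b t = 0" using SR_orth[OF ab(1) t] by (simp add: ab(3) X.ip_simps)
  qed
  then have "x \<in> S" using ab by simp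
  moreover have "ipx x (fst v) = ipy y (snd v)" if "v \<in> W" for v
  proof -
    have "(\<lambda>n. ipx (s n) (fst v)) \<longlonglongrightarrow> ipx x (fst v)" by (rule X.ip_tendsto[OF x]) simp
    then show ?thesis using lim[OF that] by (rule LIMSEQ_unique)
  qed
  ultimately have "U x y" by (simp add: U_def)
  then show ?thesis by blast
qed

theorem unit_equiv: "unit_equiv ipx S ipy UNIV"
proof -
  define u where "u s = (THE y. U s y)" for s
  have Uu: "U s (u s)" if s: "s \<in> S" for s
  proof -
    obtain y where "U s y" using U_approx[OF s] by blast
    then show ?thesis unfolding u_def by (rule theI) (rule U_unique_right[OF _ \<open>U s y\<close>])
  qed
  have u_eq: "u s = y" if "U s y" for s y
    using U_unique_right[OF Uu that] that by (simp add: U_def)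
  have "inj_on u S"
    using Uu U_unique_left by (metis inj_onI)
  moreover have "u ` S = UNIV"
  proof -
    have "y \<in> u ` S" for y
      using U_surj[of y] u_eq by (force simp: U_def)
    then show ?thesis by blast
  qed
  moreover have "u (s + t) = u s + u t" if "s \<in> S" "t \<in> S" for s t
    using Uu[OF that(1)] Uu[OF that(2)]
    by (intro u_eq) (simp add: U_def X.ip_simps Y.ip_simps cv.subspace_add[OF S_sub])
  moreover have "u (scaleC c s) = scaleC c (u s)" if "s \<in> S" for c s
    using Uu[OF that] by (intro u_eq) (simp add: U_def X.ip_simps Y.ip_simps cv.subspace_scale[OF S_sub])
  moreover have "ipy (u s) (u t) = ipx s t" if "s \<in> S" "t \<in> S" for s t
    using U_iso[OF Uu Uu, OF that] by simp
  ultimately show ?thesis unfolding unit_equiv_def bij_betw_def by blast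
qed

end

subsection \<open>Operator representations of a function\<close>

text \<open>On the resolvent set \<open>res_rel A z\<close> is the graph of a bounded operator, so
  the definite description in \<open>resolvent\<close> selects its value. The other two claims
  translate between that value and membership in \<open>A\<close>.\<close>

lemma resolvent_graph:
  assumes "z \<in> resolvent_set ip A"
  shows "bnd_KK ip (resolvent A z)"
    and "(resolvent A z x, x + scaleC z (resolvent A z x)) \<in> A"
    and "(f, f') \<in> A \<Longrightarrow> resolvent A z (f' - scaleC z f) = f"
proof -
  obtain T where T: "bnd_KK ip T" "res_rel A z = {(x, T x) | x. True}"
    using assms by (auto simp: resolvent_set_def)
  have res: "resolvent A z = T" by (rule ext) (simp add: resolvent_def T(2))
  show "bnd_KK ip (resolvent A z)" using T(1) res by simp
  have "(x, T x) \<in> res_rel A z" using T(2) by auto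
  then obtain g where "(T x, g) \<in> A" "x = g - scaleC z (T x)" by (auto simp: res_rel_def)
  then show "(resolvent A z x, x + scaleC z (resolvent A z x)) \<in> A" by (simp add: res algebra_simps)
  show "(f, f') \<in> A \<Longrightarrow> resolvent A z (f' - scaleC z f) = f"
  proof -
    assume "(f, f') \<in> A"
    then have "(f' - scaleC z f, f) \<in> res_rel A z" by (auto simp: res_rel_def)
    then show ?thesis using T(2) res by auto
  qed
qed

locale represented = pontryagin_decomp ip P N + H: hermitian hip
  for ip :: "'k::cvec \<Rightarrow> 'k \<Rightarrow> complex" and P N and hip :: "'h::cvec \<Rightarrow> 'h \<Rightarrow> complex" +
  fixes A \<Gamma> z0 Q D
  assumes rep: "represents hip ip A \<Gamma> z0 Q D"
    and Q_sym: "\<And>z h g. z \<in> D \<Longrightarrow> hip (Q (cnj z) h) g = hip h (Q z g)"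
begin

abbreviation G :: "complex \<Rightarrow> 'h \<Rightarrow> 'k" where "G \<equiv> Gamma_z A \<Gamma> z0"

lemma D_res: "z \<in> D \<Longrightarrow> z \<in> resolvent_set ip A"
  using rep by (auto simp: represents_def)

lemma z0_D: "z0 \<in> D"
  using rep by (auto simp: represents_def)

lemma A_sub: "cv.subspace A"
  using rep by (simp add: represents_def selfadjoint_rel_def csubspace_iff)

lemma A_sym: "(f, f') \<in> A \<Longrightarrow> (g, g') \<in> A \<Longrightarrow> ip f' g = ip f g'"
proof -
  assume "(f, f') \<in> A" "(g, g') \<in> A"
  moreover have "A = rel_adjoint ip A" using rep by (simp add: represents_def selfadjoint_rel_def)
  ultimately show ?thesis unfolding rel_adjoint_def by blast
qed

lemma Q_rep: "z \<in> D \<Longrightarrow> hip (Q z h) g = hip h (Q z0 g) + (z - cnj z0) * ip (G z h) (\<Gamma> g)"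
  using rep by (auto simp: represents_def)

text \<open>Expanding both sides with the representation leaves four products of
  \<open>\<Gamma> h\<close>, \<open>\<Gamma> g\<close> and their resolvent images; symmetry of
  \<open>A\<close> eliminates one of them, and the base point cancels. The right-hand side depends
  on \<open>Q\<close> alone, which is what makes different representations comparable.\<close>

lemma gram:
  assumes z: "z \<in> D" and w: "w \<in> D" and zw: "z \<noteq> cnj w"
  shows "ip (G z h) (G w g) = nker hip Q z h w g"
proof -
  define u f where "u = resolvent A z (\<Gamma> h)" and "f = resolvent A w (\<Gamma> g)"
  define a b c d where "a = ip (\<Gamma> h) (\<Gamma> g)" and "b = ip (\<Gamma> h) f" and "c = ip u f" and "d = ip u (\<Gamma> g)"
  have "(u, \<Gamma> h + scaleC z u) \<in> A" "(f, \<Gamma> g + scaleC w f) \<in> A"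
    unfolding u_def f_def using resolvent_graph(2) D_res z w by blast+
  from A_sym[OF this] have "b + z * c = d + cnj w * c"
    by (simp add: ip_simps a_def b_def c_def d_def)
  \<comment> \<open>This is the resolvent identity in weak form.\<close>
  then have d: "d = b + (z - cnj w) * c" by (simp add: algebra_simps)
  have G: "ip (G z h) (G w g) = a + cnj (w - z0) * b + (z - z0) * d + (z - z0) * cnj (w - z0) * c"
    by (simp add: Gamma_z_def u_def[symmetric] f_def[symmetric] ip_simps a_def b_def c_def d_def algebra_simps)
  have q: "hip (Q y h) g = hip h (Q z0 g) + (y - cnj z0) * (ip (\<Gamma> h) (\<Gamma> g) + (y - z0) * ip (resolvent A y (\<Gamma> h)) (\<Gamma> g))"
    if "y \<in> D" for y h g
    unfolding Q_rep[OF that] by (simp add: Gamma_z_def ip_simps)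
  have q1: "hip (Q z h) g = hip h (Q z0 g) + (z - cnj z0) * (a + (z - z0) * d)"
    using q[OF z] by (simp add: a_def d_def u_def)
  have q0: "hip (Q z0 h) g = hip h (Q z0 g) + (z0 - cnj z0) * a"
    using q[OF z0_D] by (simp add: a_def)
  \<comment> \<open>Expanding at \<open>w\<close> and conjugating, instead of expanding at
    \<open>cnj w\<close>, produces \<open>b\<close>, the product with the resolvent at
    \<open>w\<close>.\<close>
  have "hip (Q (cnj w) h) g = cnj (hip (Q w g) h)"
    using Q_sym[OF w] H.sym by metis
  also have "\<dots> = hip (Q z0 h) g + (cnj w - z0) * (a + cnj (w - z0) * b)"
    using q[OF w, of g h] H.sym[of "Q z0 h" g] sym[of "\<Gamma> g" "\<Gamma> h"] sym[of f "\<Gamma> h"]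
    by (simp add: a_def b_def f_def)
  finally have q2: "hip (Q (cnj w) h) g = hip h (Q z0 g) + (z0 - cnj z0) * a + (cnj w - z0) * (a + cnj (w - z0) * b)"
    by (simp add: q0)
  have "ip (G z h) (G w g) * (z - cnj w) = hip (Q z h) g - hip (Q (cnj w) h) g"
    unfolding G q1 q2 d by (simp add: algebra_simps)
  then show ?thesis using zw by (simp add: nker_def eq_divide_eq)
qed

text \<open>Subtracting the graph relations at \<open>z\<close> and \<open>z'\<close> gives the resolvent identity
  \<open>R(z) - R(z') = (z - z') R(z) R(z')\<close> for \<open>R(z) = (A - z)\<^sup>-\<^sup>1\<close>, which bounds \<open>R(z') \<Gamma> h\<close> by \<open>2 R(z) \<Gamma> h\<close> in norm for \<open>z'\<close> near \<open>z\<close>.\<close>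
lemma G_lipschitz:
  assumes z: "z \<in> D"
  shows "\<exists>C r. 0 < r \<and> (\<forall>z'\<in>D. cmod (z - z') \<le> r \<longrightarrow> nrm (G z h - G z' h) \<le> C * cmod (z - z'))"
proof -
  have "bnd_KK ip (resolvent A z)" by (rule resolvent_graph(1)[OF D_res[OF z]])
  then obtain C0 where C0: "\<And>x. nrm (resolvent A z x) \<le> C0 * nrm x"
    using dec unfolding bnd_KK_def bnd_op_def by blast
  \<comment> \<open>The maximum with 1 makes \<open>C\<close> positive; on the radius
    \<open>1 / (2 * C)\<close> the resolvent identity has contraction factor at most 1/2.\<close>
  define C where "C = max C0 1"
  have C: "C > 0" by (simp add: C_def)
  have CR: "nrm (resolvent A z x) \<le> C * nrm x" for x
  proof -
    have "C0 * nrm x \<le> C * nrm x" by (intro mult_right_mono) (auto simp: C_def)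
    with C0[of x] show ?thesis by linarith
  qed
  define u where "u = resolvent A z (\<Gamma> h)"
  have "nrm (G z h - G z' h) \<le> (cmod (z - z0) * (2 * C * nrm u) + 2 * nrm u) * cmod (z - z')"
    if z': "z' \<in> D" and close: "cmod (z - z') \<le> 1 / (2 * C)" for z'
  proof -
    define v where "v = resolvent A z' (\<Gamma> h)"
    have "(u, \<Gamma> h + scaleC z u) \<in> A" "(v, \<Gamma> h + scaleC z' v) \<in> A"
      unfolding u_def v_def using resolvent_graph(2) D_res z z' by blast+
    from cv.subspace_diff[OF A_sub this]
    have "(u - v, scaleC z u - scaleC z' v) \<in> A" by (simp add: minus_prod_def)
    from resolvent_graph(3)[OF D_res[OF z] this]
    have "u - v = resolvent A z (scaleC (z - z') v)"
      by (simp add: cv.scale_right_diff_distrib cv.scale_left_diff_distrib)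
    then have uv: "nrm (u - v) \<le> C * (cmod (z - z') * nrm v)"
      using CR[of "scaleC (z - z') v"] by (simp add: nrm_scale)
    also have "\<dots> = (C * cmod (z - z')) * nrm v" by simp
    also have "\<dots> \<le> (1 / 2) * nrm v"
      using close C by (intro mult_right_mono) (auto simp: field_simps)
    finally have "nrm (u - v) \<le> nrm v / 2" by simp
    moreover have "nrm v \<le> nrm (u - v) + nrm u"
      using nrm_add[of "v - u" u] nrm_commute[of v u] by simp
    ultimately have v: "nrm v \<le> 2 * nrm u" by simp
    have "C * (cmod (z - z') * nrm v) \<le> C * (cmod (z - z') * (2 * nrm u))"
      using v C by (intro mult_left_mono) auto
    with uv have uv': "nrm (u - v) \<le> 2 * C * nrm u * cmod (z - z')" by (simp add: mult_ac)
    have "G z h - G z' h = scaleC (z - z0) (u - v) + scaleC (z - z') v"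
      by (simp add: Gamma_z_def u_def[symmetric] v_def[symmetric]
          cv.scale_right_diff_distrib cv.scale_left_diff_distrib)
    then have "nrm (G z h - G z' h) \<le> cmod (z - z0) * nrm (u - v) + cmod (z - z') * nrm v"
      using nrm_add[of "scaleC (z - z0) (u - v)" "scaleC (z - z') v"] by (simp add: nrm_scale)
    also have "\<dots> \<le> cmod (z - z0) * (2 * C * nrm u * cmod (z - z')) + cmod (z - z') * (2 * nrm u)"
      using uv' v by (intro add_mono mult_left_mono) auto
    finally show ?thesis by (simp add: algebra_simps)
  qed
  then show ?thesis using C
    by (intro exI[of _ "cmod (z - z0) * (2 * C * nrm u) + 2 * nrm u"] exI[of _ "1 / (2 * C)"]) auto
qed

lemma G_cont:
  assumes z: "z \<in> D" and e: "e > 0"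
  shows "\<exists>r>0. \<forall>z'\<in>D. cmod (z - z') < r \<longrightarrow> nrm (G z h - G z' h) < e"
proof -
  obtain C r where r: "r > 0" and C: "\<forall>z'\<in>D. cmod (z - z') \<le> r \<longrightarrow> nrm (G z h - G z' h) \<le> C * cmod (z - z')"
    using G_lipschitz[OF z] by blast
  define s where "s = min r (e / (\<bar>C\<bar> + 1))"
  have s: "s > 0" using r e by (simp add: s_def)
  have "nrm (G z h - G z' h) < e" if "z' \<in> D" "cmod (z - z') < s" for z'
  proof -
    have "nrm (G z h - G z' h) \<le> C * cmod (z - z')" using C that by (simp add: s_def)
    also have "\<dots> \<le> (\<bar>C\<bar> + 1) * cmod (z - z')" by (intro mult_right_mono) auto
    also have "\<dots> < e" using that(2) by (simp add: s_def pos_less_divide_eq mult.commute)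
    finally show ?thesis .
  qed
  with s show ?thesis by blast
qed

end

text \<open>A dense part of \<open>D\<close> on which \<open>z = cnj w\<close> never happens, so that all Gram entries are
  given by the difference quotients in the kernel.\<close>
definition generic :: "complex set \<Rightarrow> complex set" where
  "generic D = {z\<in>D. (Im z > 0 \<and> Re z \<in> \<rat>) \<or> (Im z < 0 \<and> Re z \<notin> \<rat>)}"

lemma generic_sub: "generic D \<subseteq> D"
  by (auto simp: generic_def)

text \<open>Conjugation flips the half plane and keeps the real part, which would have to be both
  rational and irrational.\<close>

lemma generic_neq_cnj: "z \<in> generic D \<Longrightarrow> w \<in> generic D \<Longrightarrow> z \<noteq> cnj w"
  by (auto simp: generic_def)

lemma irrational_between:
  fixes a b :: real assumes "a < b" shows "\<exists>x. x \<notin> \<rat> \<and> a < x \<and> x < b"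
proof (rule ccontr)
  assume "\<not> ?thesis"
  then have "{a<..<b} \<subseteq> \<rat>" by auto
  then have "countable {a<..<b}" using countable_rat countable_subset by blast
  then show False using assms uncountable_open_interval by blast
qed

text \<open>Only the real part is moved, so the half plane, and with it the required kind of real
  part, stays the same.\<close>

lemma generic_dense:
  assumes D: "open D" "D \<subseteq> {z. Im z \<noteq> 0}" and z: "z \<in> D" and r: "r > 0"
  obtains z' where "z' \<in> generic D" "cmod (z - z') < r"
proof -
  obtain e where e: "e > 0" "ball z e \<subseteq> D" using D(1) z openE by blast
  define s where "s = min e r"
  have s: "s > 0" using e r by (simp add: s_def)
  have "\<exists>x. (if Im z > 0 then x \<in> \<rat> else x \<notin> \<rat>) \<and> Re z < x \<and> x < Re z + s"
    using Rats_dense_in_real[of "Re z" "Re z + s"] irrational_between[of "Re z" "Re z + s"] s by auto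
  then obtain x where x: "if Im z > 0 then x \<in> \<rat> else x \<notin> \<rat>" "Re z < x" "x < Re z + s" by blast
  define z' where "z' = Complex x (Im z)"
  have "z - z' = complex_of_real (Re z - x)" by (simp add: z'_def complex_eq_iff)
  then have cz: "cmod (z - z') < s" using x(2,3) by (simp only: norm_of_real)
  then have "z' \<in> ball z e" by (simp add: s_def dist_norm)
  then have "z' \<in> D" using e(2) by blast
  moreover have "Im z \<noteq> 0" using D(2) z by blast
  ultimately have "z' \<in> generic D" using x(1) by (auto simp: generic_def z'_def split: if_splits)
  with cz show ?thesis by (intro that) (auto simp: s_def)
qed

context represented
begin

lemma G_generic_ncl:
  assumes D: "open D" "D \<subseteq> {z. Im z \<noteq> 0}" and z: "z \<in> D"
  shows "G z h \<in> ncl {G w h | w. w \<in> generic D}"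
  unfolding ncl_def
proof (intro CollectI allI impI)
  fix e :: real assume "e > 0"
  from G_cont[OF z this] obtain r where r: "r > 0" "\<forall>z'\<in>D. cmod (z - z') < r \<longrightarrow> nrm (G z h - G z' h) < e"
    by blast
  obtain z' where "z' \<in> generic D" "cmod (z - z') < r" using generic_dense[OF D z r(1)] .
  with r(2) generic_sub show "\<exists>s\<in>{G w h | w. w \<in> generic D}. nrm (G z h - s) < e" by blast
qed

text \<open>Minimality survives the restriction to \<open>generic D\<close> because the representing
  vectors depend continuously on the point.\<close>

lemma generic_span_dense:
  assumes D: "open D" "D \<subseteq> {z. Im z \<noteq> 0}"
    and minimal: "pclosure ip (cspan {G z h | z h. z \<in> D}) = UNIV"
  shows "ncl (cv.span {G z h | z h. z \<in> generic D}) = UNIV"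
proof -
  let ?M = "cv.span {G z h | z h. z \<in> generic D}"
  have "G z h \<in> ncl ?M" if "z \<in> D" for z h
  proof -
    have "{G w h | w. w \<in> generic D} \<subseteq> ?M" by (auto intro: cv.span_base)
    then show ?thesis using G_generic_ncl[OF D that] ncl_mono by blast
  qed
  then have "cspan {G z h | z h. z \<in> D} \<subseteq> ncl ?M"
    unfolding cspan_eq_span by (intro cv.span_minimal ncl_subspace cv.subspace_span) auto
  then have "pclosure ip (cspan {G z h | z h. z \<in> D}) \<subseteq> ncl (ncl ?M)"
    using pclosure_ncl ncl_mono by blast
  then show ?thesis using ncl_idem minimal by blast
qed

end

section \<open>Negative dimension and Gram matrices\<close>

context hermitian
begin

text \<open>Exchanges lists for indexed families, the form shared by \<open>gram_schmidt\<close> and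
  \<open>mat_neg_dim\<close>.\<close>

lemma neg_dim_iff:
  assumes S: "cv.subspace S"
  shows "neg_dim ip S d \<longleftrightarrow> (\<exists>f. (\<forall>k<d. f k \<in> S) \<and> (\<forall>c. (\<exists>k<d. c k \<noteq> 0) \<longrightarrow>
     Re (ip (\<Sum>k<d. scaleC (c k) (f k)) (\<Sum>k<d. scaleC (c k) (f k))) < 0))"
proof
  assume "neg_dim ip S d"
  then obtain vs where vs: "length vs = d" "set vs \<subseteq> S"
    and neg: "\<And>cs. length cs = d \<Longrightarrow> \<exists>c\<in>set cs. c \<noteq> 0 \<Longrightarrow> Re (ip (lincomb cs vs) (lincomb cs vs)) < 0"
    by (auto simp: neg_dim_def)
  have "Re (ip (\<Sum>k<d. scaleC (c k) (vs ! k)) (\<Sum>k<d. scaleC (c k) (vs ! k))) < 0"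
    if "\<exists>k<d. c k \<noteq> 0" for c
  proof -
    have "lincomb (map c [0..<d]) vs = (\<Sum>k<d. scaleC (c k) (vs ! k))"
      using vs(1) by (subst lincomb_nth) auto
    moreover have "\<exists>b\<in>set (map c [0..<d]). b \<noteq> 0" using that by auto
    ultimately show ?thesis using neg[of "map c [0..<d]"] by simp
  qed
  then show "\<exists>f. (\<forall>k<d. f k \<in> S) \<and> (\<forall>c. (\<exists>k<d. c k \<noteq> 0) \<longrightarrow>
     Re (ip (\<Sum>k<d. scaleC (c k) (f k)) (\<Sum>k<d. scaleC (c k) (f k))) < 0)"
    using vs by (intro exI[of _ "\<lambda>k. vs ! k"]) auto
next
  assume "\<exists>f. (\<forall>k<d. f k \<in> S) \<and> (\<forall>c. (\<exists>k<d. c k \<noteq> 0) \<longrightarrow>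
     Re (ip (\<Sum>k<d. scaleC (c k) (f k)) (\<Sum>k<d. scaleC (c k) (f k))) < 0)"
  then obtain f where f: "\<And>k. k < d \<Longrightarrow> f k \<in> S" and neg: "\<And>c. \<exists>k<d. c k \<noteq> 0 \<Longrightarrow>
     Re (ip (\<Sum>k<d. scaleC (c k) (f k)) (\<Sum>k<d. scaleC (c k) (f k))) < 0"
    by blast
  show "neg_dim ip S d" unfolding neg_dim_def
  proof (intro exI[of _ "map f [0..<d]"] conjI allI impI)
    fix cs :: "complex list" assume cs: "length cs = d \<and> (\<exists>c\<in>set cs. c \<noteq> 0)"
    then have "lincomb cs (map f [0..<d]) = (\<Sum>k<d. scaleC (cs ! k) (f k))"
      by (subst lincomb_nth) auto
    moreover have "\<exists>k<d. cs ! k \<noteq> 0" using cs by (auto simp: in_set_conv_nth)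
    ultimately show "Re (ip (lincomb cs (map f [0..<d])) (lincomb cs (map f [0..<d]))) < 0"
      using neg[of "\<lambda>k. cs ! k"] by simp
  qed (use f in auto)
qed

text \<open>The Gram matrix is close to minus the identity. With entrywise errors below 1/(2(d+1))
  the error form is at most d/(2(d+1)) times the sum of the squared moduli of the
  \<open>c i\<close>, by Cauchy-Schwarz, and hence cannot outweigh the main term.\<close>

lemma gram_perturb:
  assumes close: "\<And>i j. i < d \<Longrightarrow> j < d \<Longrightarrow>
      cmod (ip (u j) (u i) - (if i = j then -1 else 0)) < 1 / (2 * (real d + 1))"
    and c: "\<exists>k<d. c k \<noteq> 0"
  shows "Re (ip (\<Sum>k<d. scaleC (c k) (u k)) (\<Sum>k<d. scaleC (c k) (u k))) < 0"
proof -
  define E where "E i j = ip (u j) (u i) - (if i = j then -1 else 0)" for i j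
  define s where "s = (\<Sum>i<d. (cmod (c i))\<^sup>2)"
  obtain k where k: "k < d" "c k \<noteq> 0" using c by blast
  have s: "s > 0" unfolding s_def using k by (intro sum_pos2[of _ k]) auto
  have "ip (\<Sum>k<d. scaleC (c k) (u k)) (\<Sum>k<d. scaleC (c k) (u k))
      = (\<Sum>i<d. \<Sum>j<d. (if i = j then - (c j * cnj (c i)) else 0) + E i j * c j * cnj (c i))"
    unfolding qf mat_qf_def by (intro sum.cong refl) (auto simp: E_def algebra_simps)
  also have "\<dots> = - (\<Sum>i<d. c i * cnj (c i)) + (\<Sum>i<d. \<Sum>j<d. E i j * c j * cnj (c i))"
    by (simp add: sum.distrib sum_subtractf sum.delta' sum_negf)
  also have "(\<Sum>i<d. c i * cnj (c i)) = complex_of_real s"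
    by (simp add: s_def complex_norm_square[symmetric])
  finally have eq: "ip (\<Sum>k<d. scaleC (c k) (u k)) (\<Sum>k<d. scaleC (c k) (u k))
      = - complex_of_real s + (\<Sum>i<d. \<Sum>j<d. E i j * c j * cnj (c i))" .
  have "cmod (\<Sum>i<d. \<Sum>j<d. E i j * c j * cnj (c i)) \<le> (\<Sum>i<d. \<Sum>j<d. 1 / (2 * (real d + 1)) * (cmod (c j) * cmod (c i)))"
  proof (intro order_trans[OF norm_sum] sum_mono)
    fix i j assume "i \<in> {..<d}" "j \<in> {..<d}"
    then have "cmod (E i j) \<le> 1 / (2 * (real d + 1))" using close by (simp add: E_def less_imp_le)
    then show "cmod (E i j * c j * cnj (c i)) \<le> 1 / (2 * (real d + 1)) * (cmod (c j) * cmod (c i))"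
      by (simp add: norm_mult mult.assoc mult_right_mono del: times_divide_eq_left)
  qed
  also have "\<dots> = 1 / (2 * (real d + 1)) * (\<Sum>i<d. cmod (c i))\<^sup>2"
    by (simp add: power2_eq_square sum_product sum_distrib_left sum_divide_distrib mult_ac)
  also have "\<dots> \<le> 1 / (2 * (real d + 1)) * (s * real d)"
    using sum_squared_le_sum_of_squares[where I = "{..<d}" and f = "\<lambda>i. cmod (c i)"]
    by (intro mult_left_mono) (auto simp: s_def)
  also have "\<dots> < s" using s by (simp add: field_simps add_nonneg_pos)
  finally have "Re (\<Sum>i<d. \<Sum>j<d. E i j * c j * cnj (c i)) < s"
    using complex_Re_le_cmod order_le_less_trans by blast
  then show ?thesis unfolding eq by simp
qed

text \<open>The coefficients \<open>a k\<close> of the vectors \<open>u k\<close> are themselves the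
  vectors that \<open>mat_neg_dim\<close> asks for.\<close>

lemma mat_neg_dim_gram:
  assumes u: "\<And>k. k < d \<Longrightarrow> u k = (\<Sum>i<n. scaleC (a k i) (g i))"
    and neg: "\<And>c. \<exists>k<d. c k \<noteq> 0 \<Longrightarrow>
      Re (ip (\<Sum>k<d. scaleC (c k) (u k)) (\<Sum>k<d. scaleC (c k) (u k))) < 0"
  shows "mat_neg_dim (\<lambda>i j. ip (g j) (g i)) n d"
  unfolding mat_neg_dim_def
proof (intro exI[of _ a] allI impI)
  fix c :: "nat \<Rightarrow> complex" assume c: "\<exists>k<d. c k \<noteq> 0"
  have "(\<Sum>i<n. scaleC (\<Sum>k<d. c k * a k i) (g i)) = (\<Sum>k<d. scaleC (c k) (u k))"
    by (simp add: u cv.scale_sum_left cv.scale_sum_right) (rule sum.swap)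
  then show "Re (mat_qf (\<lambda>i j. ip (g j) (g i)) n (\<lambda>i. \<Sum>k<d. c k * a k i)) < 0"
    using neg[OF c] qf[of "\<lambda>i. \<Sum>k<d. c k * a k i" g n] by simp
qed

lemma gram_neg_dim:
  assumes "mat_neg_dim (\<lambda>i j. ip (g j) (g i)) n d"
  shows "neg_dim ip UNIV d"
proof -
  obtain v where v: "\<And>c. \<exists>k<d. c k \<noteq> 0 \<Longrightarrow>
      Re (mat_qf (\<lambda>i j. ip (g j) (g i)) n (\<lambda>i. \<Sum>k<d. c k * v k i)) < 0"
    using assms unfolding mat_neg_dim_def by blast
  have "(\<Sum>i<n. scaleC (\<Sum>k<d. c k * v k i) (g i)) = (\<Sum>k<d. scaleC (c k) (\<Sum>i<n. scaleC (v k i) (g i)))" for c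
    by (simp add: cv.scale_sum_left cv.scale_sum_right) (rule sum.swap)
  then show ?thesis
    unfolding neg_dim_iff[OF cv.subspace_UNIV]
    using v qf[of "\<lambda>i. \<Sum>k<d. _ k * v k i" g n]
    by (intro exI[of _ "\<lambda>k. \<Sum>i<n. scaleC (v k i) (g i)"]) (simp add: qf[symmetric])
qed

end

lemma mat_neg_dim_cong:
  assumes "\<And>i j. i < n \<Longrightarrow> j < n \<Longrightarrow> M i j = M' i j"
  shows "mat_neg_dim M n d = mat_neg_dim M' n d"
proof -
  have "mat_qf M n x = mat_qf M' n x" for x
    unfolding mat_qf_def using assms by (intro sum.cong) auto
  then show ?thesis by (simp add: mat_neg_dim_def)
qed

text \<open>Normalising by \<open>gram_schmidt\<close> before approximating makes the admissible
  error independent of the coefficients \<open>c\<close>, so closeness of finitely many Gram entries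
  suffices.\<close>

lemma (in pontryagin_decomp) neg_dim_approx:
  assumes dense: "ncl M = UNIV" and neg: "neg_dim ip UNIV d"
  shows "\<exists>u. (\<forall>k. u k \<in> M) \<and> (\<forall>c. (\<exists>k<d. c k \<noteq> 0) \<longrightarrow>
     Re (ip (\<Sum>k<d. scaleC (c k) (u k)) (\<Sum>k<d. scaleC (c k) (u k))) < 0)"
proof -
  obtain f where f: "\<And>c. \<exists>k<d. c k \<noteq> 0 \<Longrightarrow>
     Re (ip (\<Sum>k<d. scaleC (c k) (f k)) (\<Sum>k<d. scaleC (c k) (f k))) < 0"
    using neg unfolding neg_dim_iff[OF cv.subspace_UNIV] by blast
  have "Re (ip (\<Sum>k<d. scaleC (c k) (f k)) (\<Sum>k<d. scaleC (c k) (f k))) < 0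
      \<or> (\<Sum>k<d. scaleC (c k) (f k)) = 0" for c
    by (cases "\<exists>k<d. c k \<noteq> 0") (use f in auto)
  from gram_schmidt[OF this] obtain e where e:
     "\<forall>i<d. \<forall>j<d. i \<noteq> j \<longrightarrow> ip (e i) (e j) = 0"
     "\<forall>i<d. e i = 0 \<or> ip (e i) (e i) = -1"
     "\<forall>i<d. \<exists>c. c i \<noteq> 0 \<and> e i = (\<Sum>k<d. scaleC (c k) (f k))"
    by (elim exE conjE)
  \<comment> \<open>The nonzero coefficient supplied by \<open>gram_schmidt\<close> rules out the
    degenerate case, as every nontrivial combination of the \<open>f k\<close> is negative.\<close>
  have "e i \<noteq> 0" if i: "i < d" for i
  proof -
    obtain c where "c i \<noteq> 0" "e i = (\<Sum>k<d. scaleC (c k) (f k))" using e(3) i by blast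
    then have "Re (ip (e i) (e i)) < 0" using f[of c] i by auto
    then show ?thesis by auto
  qed
  then have gram: "ip (e j) (e i) = (if i = j then -1 else 0)" if "i < d" "j < d" for i j
    using e(1,2) that by auto
  have "\<exists>xs. (\<forall>n. xs n \<in> M) \<and> (\<lambda>n. nrm (xs n - e k)) \<longlonglongrightarrow> 0" for k
  proof -
    have "e k \<in> ncl M" using dense by simp
    then show ?thesis by (rule ncl_seq) blast
  qed
  then have "\<forall>k. \<exists>xs. (\<forall>n. xs n \<in> M) \<and> (\<lambda>n. nrm (xs n - e k)) \<longlonglongrightarrow> 0" ..
  from choice[OF this] obtain x where x: "\<And>k n. x k n \<in> M" "\<And>k. (\<lambda>n. nrm (x k n - e k)) \<longlonglongrightarrow> 0"
    by blast
  have "\<forall>\<^sub>F n in sequentially. cmod (ip (x j n) (x i n) - (if i = j then -1 else 0)) < 1 / (2 * (real d + 1))"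
    if "i < d" "j < d" for i j
  proof -
    have "(\<lambda>n. cmod (ip (x j n) (x i n) - ip (e j) (e i))) \<longlonglongrightarrow> 0"
      by (intro tendsto_norm_zero LIM_zero ip_tendsto x)
    from order_tendstoD(2)[OF this, of "1 / (2 * (real d + 1))"] show ?thesis
      using gram[OF that] by simp
  qed
  then have "\<forall>\<^sub>F n in sequentially. \<forall>i\<in>{..<d}. \<forall>j\<in>{..<d}.
      cmod (ip (x j n) (x i n) - (if i = j then -1 else 0)) < 1 / (2 * (real d + 1))"
    by (intro eventually_ball_finite ballI) auto
  then obtain n where n: "\<And>i j. i < d \<Longrightarrow> j < d \<Longrightarrow>
      cmod (ip (x j n) (x i n) - (if i = j then -1 else 0)) < 1 / (2 * (real d + 1))"
    by (auto simp: eventually_sequentially)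
  show ?thesis
    using x(1) gram_perturb[OF n] by (intro exI[of _ "\<lambda>k. x k n"]) blast
qed

text \<open>The definition of negative squares admits only points with no conjugate pairs. Its
  witnesses give the lower bound directly; for the upper bound a negative family is moved into the
  span over \<open>generic D\<close>, where this condition holds automatically.\<close>

lemma (in represented) state_space_neg_index:
  assumes D: "open D" "D \<subseteq> {z. Im z \<noteq> 0}"
    and minimal: "pclosure ip (cspan {G z h | z h. z \<in> D}) = UNIV"
    and ker: "kernel_neg_squares hip Q D \<kappa>"
  shows "has_neg_index ip UNIV \<kappa>"
  unfolding has_neg_index_def
proof (intro conjI allI impI)
  have kernel: "mat_neg_dim (\<lambda>i j. nker hip Q (zs j) (hs j) (zs i) (hs i)) n d
      = mat_neg_dim (\<lambda>i j. ip (G (zs j) (hs j)) (G (zs i) (hs i))) n d"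
    if "\<And>i. i < n \<Longrightarrow> zs i \<in> D" "\<And>i j. i < n \<Longrightarrow> j < n \<Longrightarrow> zs i \<noteq> cnj (zs j)" for zs hs n d
    using that by (intro mat_neg_dim_cong gram[symmetric]) auto
  obtain n zs hs where z: "\<forall>i<n. zs i \<in> D" "\<forall>i<n. \<forall>j<n. zs i \<noteq> cnj (zs j)"
    "mat_neg_dim (\<lambda>i j. nker hip Q (zs j) (hs j) (zs i) (hs i)) n \<kappa>"
    using ker unfolding kernel_neg_squares_def by blast
  have "mat_neg_dim (\<lambda>i j. ip (G (zs j) (hs j)) (G (zs i) (hs i))) n \<kappa>"
    using kernel[of n zs hs \<kappa>] z by simp
  then show "neg_dim ip UNIV \<kappa>" by (rule gram_neg_dim)
  fix d assume "neg_dim ip UNIV d"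
  from neg_dim_approx[OF generic_span_dense[OF D minimal] this] obtain u where
    u: "\<forall>k. u k \<in> cv.span {G z h | z h. z \<in> generic D}"
      "\<forall>c. (\<exists>k<d. c k \<noteq> 0) \<longrightarrow> Re (ip (\<Sum>k<d. scaleC (c k) (u k)) (\<Sum>k<d. scaleC (c k) (u k))) < 0"
    by (elim exE conjE)
  from span_finite_family[of d u, OF u(1)[rule_format]] obtain n :: nat and g a where
    g: "\<forall>i<n. g i \<in> {G z h | z h. z \<in> generic D}"
    and ua: "\<forall>k<d. u k = (\<Sum>i<n. scaleC (a k i) (g i))"
    by (elim exE conjE)
  have "\<forall>i. \<exists>p. i < n \<longrightarrow> fst p \<in> generic D \<and> g i = G (fst p) (snd p)" using g by fastforce
  from choice[OF this] obtain p where p: "\<And>i. i < n \<Longrightarrow> fst (p i) \<in> generic D"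
    "\<And>i. i < n \<Longrightarrow> g i = G (fst (p i)) (snd (p i))" by blast
  have "mat_neg_dim (\<lambda>i j. ip (g j) (g i)) n d"
    using mat_neg_dim_gram[OF ua[rule_format] u(2)[rule_format]] by blast
  then have "mat_neg_dim (\<lambda>i j. ip (G (fst (p j)) (snd (p j))) (G (fst (p i)) (snd (p i)))) n d"
    using p(2) by (subst (asm) mat_neg_dim_cong) auto
  then have "mat_neg_dim (\<lambda>i j. nker hip Q (fst (p j)) (snd (p j)) (fst (p i)) (snd (p i))) n d"
    using kernel[of n "\<lambda>i. fst (p i)" "\<lambda>i. snd (p i)" d] p(1) generic_sub generic_neq_cnj by blast
  then show "d \<le> \<kappa>"
    using ker[unfolded kernel_neg_squares_def, THEN conjunct1, rule_format, of n "\<lambda>i. fst (p i)" "\<lambda>i. snd (p i)" d]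
      p(1) generic_sub generic_neq_cnj by blast
qed

subsection \<open>Orthogonal sums\<close>

text \<open>Used to show that the span of the embedded generators of both factors contains the
  product of their spans.\<close>

lemma subspace_slices:
  fixes S :: "('a::cvec \<times> 'b::cvec) set"
  assumes S: "cv.subspace S"
  shows "cv.subspace {v. (v, 0) \<in> S}" and "cv.subspace {w. (0, w) \<in> S}"
proof -
  show "cv.subspace {v. (v, 0) \<in> S}"
    using cv.subspace_0[OF S] cv.subspace_add[OF S, of "(_, 0)" "(_, 0)"] cv.subspace_scale[OF S, of "(_, 0)"]
    by (intro cv.subspaceI) (auto simp: scaleC_prod_def zero_prod_def)
  show "cv.subspace {w. (0, w) \<in> S}"
    using cv.subspace_0[OF S] cv.subspace_add[OF S, of "(0, _)" "(0, _)"] cv.subspace_scale[OF S, of "(0, _)"]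
    by (intro cv.subspaceI) (auto simp: scaleC_prod_def zero_prod_def)
qed

lemma sum_ip_adm_decomp:
  assumes d1: "pontryagin_decomp ip1 P1 N1" and d2: "pontryagin_decomp ip2 P2 N2"
  shows "pontryagin_decomp (sum_ip ip1 ip2) (P1 \<times> P2) (N1 \<times> N2)"
proof -
  interpret a: pontryagin_decomp ip1 P1 N1 by (rule d1)
  interpret b: pontryagin_decomp ip2 P2 N2 by (rule d2)
  let ?ip = "sum_ip ip1 ip2"
  have herm: "sesq_herm ?ip"
    unfolding sesq_herm_def
  proof (intro conjI allI)
    fix x y z :: "'a \<times> 'b" and c
    show "?ip (x + y) z = ?ip x z + ?ip y z" by (simp add: sum_ip_def a.ip_simps b.ip_simps)
    show "?ip (scaleC c x) y = c * ?ip x y"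
      by (simp add: sum_ip_def scaleC_prod_def a.ip_simps b.ip_simps distrib_left)
    show "?ip y x = cnj (?ip x y)"
      using a.sym[of "fst x" "fst y"] b.sym[of "snd x" "snd y"] by (simp add: sum_ip_def)
  qed
  have sub: "csubspace (A \<times> B)" if "cv.subspace A" "cv.subspace B" for A :: "'a set" and B :: "'b set"
    using that by (auto simp: csubspace_def scaleC_prod_def zero_prod_def cv.subspace_def)
  have UN: "ssum (P1 \<times> P2) (N1 \<times> N2) = UNIV"
  proof -
    have "x \<in> ssum (P1 \<times> P2) (N1 \<times> N2)" for x
      unfolding ssum_def
      by (intro CollectI bexI[of _ "(a.pp (fst x), b.pp (snd x))"] bexI[of _ "(a.nn (fst x), b.nn (snd x))"])
        (auto simp: a.pp_in a.nn_in b.pp_in b.nn_in a.pp_nn b.pp_nn)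
    then show ?thesis by blast
  qed
  have fin: "\<exists>vs. N1 \<times> N2 = cspan (set vs)"
  proof -
    obtain vs ws where vs: "N1 = cv.span (set vs)" and ws: "N2 = cv.span (set ws)"
      using a.N_fin b.N_fin by blast
    let ?us = "map (\<lambda>v. (v, 0)) vs @ map (\<lambda>w. (0, w)) ws"
    let ?S = "cv.span (set ?us)"
    have "cv.subspace {v. (v, 0 :: 'b) \<in> ?S}"
      by (rule subspace_slices[OF cv.subspace_span])
    moreover have "set vs \<subseteq> {v. (v, 0 :: 'b) \<in> ?S}" by (auto intro: cv.span_base)
    ultimately have 1: "N1 \<subseteq> {v. (v, 0 :: 'b) \<in> ?S}" unfolding vs by (intro cv.span_minimal)
    have "cv.subspace {w. (0 :: 'a, w) \<in> ?S}"
      by (rule subspace_slices[OF cv.subspace_span])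
    moreover have "set ws \<subseteq> {w. (0 :: 'a, w) \<in> ?S}" by (auto intro: cv.span_base)
    ultimately have 2: "N2 \<subseteq> {w. (0 :: 'a, w) \<in> ?S}" unfolding ws by (intro cv.span_minimal)
    have "N1 \<times> N2 \<subseteq> ?S"
    proof
      fix x assume "x \<in> N1 \<times> N2"
      then have "(fst x, 0) + (0, snd x) \<in> ?S" using 1 2 by (intro cv.span_add) auto
      then show "x \<in> ?S" by simp
    qed
    moreover have "?S \<subseteq> N1 \<times> N2"
      using sub[OF a.N_sub b.N_sub] cv.subspace_0[OF a.N_sub] cv.subspace_0[OF b.N_sub]
      by (intro cv.span_minimal) (auto simp: csubspace_iff vs ws intro: cv.span_base)
    ultimately show ?thesis unfolding cspan_eq_span by blast
  qed
  have complete: "ncomplete (\<lambda>p. sqrt (Re (?ip p p))) (P1 \<times> P2)"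
    unfolding ncomplete_def
  proof (intro allI impI, elim conjE)
    fix xs :: "nat \<Rightarrow> 'a \<times> 'b"
    assume xs: "\<forall>k. xs k \<in> P1 \<times> P2"
      and c: "\<forall>e>0. \<exists>M. \<forall>m\<ge>M. \<forall>n\<ge>M. sqrt (Re (?ip (xs m - xs n) (xs m - xs n))) < e"
    have pos1: "0 \<le> Re (ip1 p p)" if "p \<in> P1" for p
      using a.P_pos[OF that] by (cases "p = 0") auto
    have pos2: "0 \<le> Re (ip2 p p)" if "p \<in> P2" for p
      using b.P_pos[OF that] by (cases "p = 0") auto
    have in1: "fst (xs m) - fst (xs n) \<in> P1" and in2: "snd (xs m) - snd (xs n) \<in> P2" for m n
      using xs[rule_format, of m] xs[rule_format, of n]
      by (auto intro: cv.subspace_diff[OF a.P_sub] cv.subspace_diff[OF b.P_sub])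
    have le1: "sqrt (Re (ip1 (fst (xs m) - fst (xs n)) (fst (xs m) - fst (xs n)))) \<le> sqrt (Re (?ip (xs m - xs n) (xs m - xs n)))"
      and le2: "sqrt (Re (ip2 (snd (xs m) - snd (xs n)) (snd (xs m) - snd (xs n)))) \<le> sqrt (Re (?ip (xs m - xs n) (xs m - xs n)))" for m n
      using pos1[OF in1[of m n]] pos2[OF in2[of m n]] by (simp_all add: sum_ip_def)
    have c1: "\<forall>e>0. \<exists>M. \<forall>m\<ge>M. \<forall>n\<ge>M. sqrt (Re (ip1 (fst (xs m) - fst (xs n)) (fst (xs m) - fst (xs n)))) < e"
      and c2: "\<forall>e>0. \<exists>M. \<forall>m\<ge>M. \<forall>n\<ge>M. sqrt (Re (ip2 (snd (xs m) - snd (xs n)) (snd (xs m) - snd (xs n)))) < e"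
      using c le1 le2 by (meson le_less_trans)+
    obtain p where p: "p \<in> P1" "(\<lambda>k. sqrt (Re (ip1 (fst (xs k) - p) (fst (xs k) - p)))) \<longlonglongrightarrow> 0"
      using a.P_complete[unfolded ncomplete_def, rule_format, of "\<lambda>k. fst (xs k)"] c1 xs
      by (auto simp: mem_Times_iff)
    obtain q where q: "q \<in> P2" "(\<lambda>k. sqrt (Re (ip2 (snd (xs k) - q) (snd (xs k) - q)))) \<longlonglongrightarrow> 0"
      using b.P_complete[unfolded ncomplete_def, rule_format, of "\<lambda>k. snd (xs k)"] c2 xs
      by (auto simp: mem_Times_iff)
    have "(\<lambda>k. sqrt (Re (?ip (xs k - (p, q)) (xs k - (p, q))))) \<longlonglongrightarrow> 0"
    proof (rule Lim_null_comparison[OF always_eventually[OF allI] tendsto_add_zero[OF p(2) q(2)]])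
      fix k
      have "0 \<le> Re (ip1 (fst (xs k) - p) (fst (xs k) - p))" "0 \<le> Re (ip2 (snd (xs k) - q) (snd (xs k) - q))"
        using xs[rule_format, of k] p(1) q(1)
        by (auto intro!: pos1 pos2 cv.subspace_diff[OF a.P_sub] cv.subspace_diff[OF b.P_sub])
      then show "norm (sqrt (Re (?ip (xs k - (p, q)) (xs k - (p, q)))))
          \<le> sqrt (Re (ip1 (fst (xs k) - p) (fst (xs k) - p))) + sqrt (Re (ip2 (snd (xs k) - q) (snd (xs k) - q)))"
        using sqrt_add_le_add_sqrt by (simp add: sum_ip_def)
    qed
    with p(1) q(1) show "\<exists>x\<in>P1 \<times> P2. (\<lambda>k. sqrt (Re (?ip (xs k - x) (xs k - x)))) \<longlonglongrightarrow> 0"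
      by (intro bexI[of _ "(p, q)"]) auto
  qed
  have pos: "0 < Re (?ip p p)" if "p \<in> P1 \<times> P2" "p \<noteq> 0" for p
  proof -
    have "fst p \<noteq> 0 \<or> snd p \<noteq> 0" using that(2) by (auto simp: prod_eq_iff)
    then show ?thesis
      using that(1) a.P_pos[of "fst p"] b.P_pos[of "snd p"]
      by (cases "fst p = 0"; cases "snd p = 0") (auto simp: sum_ip_def add_pos_pos)
  qed
  have neg: "Re (?ip p p) < 0" if "p \<in> N1 \<times> N2" "p \<noteq> 0" for p
  proof -
    have "fst p \<noteq> 0 \<or> snd p \<noteq> 0" using that(2) by (auto simp: prod_eq_iff)
    then show ?thesis
      using that(1) a.N_neg[of "fst p"] b.N_neg[of "snd p"]
      by (cases "fst p = 0"; cases "snd p = 0") (auto simp: sum_ip_def add_neg_neg)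
  qed
  have "P1 \<times> P2 \<inter> N1 \<times> N2 = {0}"
    using a.PN_int b.PN_int by (auto simp: zero_prod_def set_eq_iff)
  moreover have "?ip p n = 0" if "p \<in> P1 \<times> P2" "n \<in> N1 \<times> N2" for p n
    using that a.PN_orth b.PN_orth by (auto simp: sum_ip_def)
  ultimately have "adm_decomp ?ip (P1 \<times> P2) (N1 \<times> N2)"
    unfolding adm_decomp_def
    using sub[OF a.P_sub b.P_sub] sub[OF a.N_sub b.N_sub] UN fin complete pos neg by blast
  with herm show ?thesis by unfold_locales
qed

text \<open>The projections act componentwise, so the squared norms add. This reduces approximation
  of pairs to approximation in each factor.\<close>

lemma sum_ip_nrm_le:
  assumes d1: "pontryagin_decomp ip1 P1 N1" and d2: "pontryagin_decomp ip2 P2 N2"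
  shows "jnorm (sum_ip ip1 ip2) (P1 \<times> P2) (N1 \<times> N2) x \<le> jnorm ip1 P1 N1 (fst x) + jnorm ip2 P2 N2 (snd x)"
proof -
  interpret a: pontryagin_decomp ip1 P1 N1 by (rule d1)
  interpret b: pontryagin_decomp ip2 P2 N2 by (rule d2)
  interpret t: pontryagin_decomp "sum_ip ip1 ip2" "P1 \<times> P2" "N1 \<times> N2"
    by (rule sum_ip_adm_decomp[OF d1 d2])
  have "x - (a.pp (fst x), b.pp (snd x)) = (a.nn (fst x), b.nn (snd x))"
    by (simp add: a.nn_def b.nn_def minus_prod_def)
  then have pp: "t.pp x = (a.pp (fst x), b.pp (snd x))"
    using a.pp_in b.pp_in a.nn_in b.nn_in by (intro t.pp_eq) auto
  then have nn: "t.nn x = (a.nn (fst x), b.nn (snd x))"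
    by (simp add: t.nn_def a.nn_def b.nn_def minus_prod_def)
  have "(t.nrm x)\<^sup>2 = (a.nrm (fst x))\<^sup>2 + (b.nrm (snd x))\<^sup>2"
    unfolding t.nrm_sq a.nrm_sq b.nrm_sq pp nn by (simp add: sum_ip_def)
  also have "\<dots> \<le> (a.nrm (fst x) + b.nrm (snd x))\<^sup>2" by (simp add: power2_sum)
  finally show ?thesis by (rule power2_le_imp_le) simp
qed

section \<open>Transport along isometries and linear relations\<close>

lemma unit_equiv_neg_dim:
  assumes "hermitian ip" "hermitian ip'" and S: "cv.subspace S" and T: "cv.subspace T"
    and eq: "unit_equiv ip S ip' T"
  shows "neg_dim ip S d \<longleftrightarrow> neg_dim ip' T d"
proof -
  interpret a: hermitian ip by fact
  interpret b: hermitian ip' by fact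
  obtain U where bij: "bij_betw U S T"
    and add: "\<And>x y. x \<in> S \<Longrightarrow> y \<in> S \<Longrightarrow> U (x + y) = U x + U y"
    and scale: "\<And>c x. x \<in> S \<Longrightarrow> U (scaleC c x) = scaleC c (U x)"
    and iso: "\<And>x y. x \<in> S \<Longrightarrow> y \<in> S \<Longrightarrow> ip' (U x) (U y) = ip x y"
    using eq by (auto simp: unit_equiv_def)
  have U0: "U 0 = 0" using scale[of 0 0] cv.subspace_0[OF S] by simp
  \<comment> \<open>\<open>U\<close> is linear only on \<open>S\<close>, so membership of the
    partial sums in \<open>S\<close> is carried through the induction.\<close>
  have comb: "(\<Sum>k<n. scaleC (c k) (f k)) \<in> S \<and>
      U (\<Sum>k<n. scaleC (c k) (f k)) = (\<Sum>k<n. scaleC (c k) (U (f k)))"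
    if "\<And>k. k < n \<Longrightarrow> f k \<in> S" for n :: nat and c f
    using that
    by (induction n) (auto simp: U0 add scale cv.subspace_0[OF S] cv.subspace_add[OF S] cv.subspace_scale[OF S])
  have form: "ip' (\<Sum>k<d. scaleC (c k) (U (f k))) (\<Sum>k<d. scaleC (c k) (U (f k)))
      = ip (\<Sum>k<d. scaleC (c k) (f k)) (\<Sum>k<d. scaleC (c k) (f k))"
    if "\<And>k. k < d \<Longrightarrow> f k \<in> S" for c f
  proof -
    have a: "(\<Sum>k<d. scaleC (c k) (f k)) \<in> S"
      and b: "U (\<Sum>k<d. scaleC (c k) (f k)) = (\<Sum>k<d. scaleC (c k) (U (f k)))"
      using comb[OF that, where c = c] by auto
    show ?thesis using iso[OF a a] by (simp only: b)
  qed
  show ?thesis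
    unfolding a.neg_dim_iff[OF S] b.neg_dim_iff[OF T]
  proof
    assume "\<exists>f. (\<forall>k<d. f k \<in> S) \<and> (\<forall>c. (\<exists>k<d. c k \<noteq> 0) \<longrightarrow>
       Re (ip (\<Sum>k<d. scaleC (c k) (f k)) (\<Sum>k<d. scaleC (c k) (f k))) < 0)"
    then obtain f where f: "\<And>k. k < d \<Longrightarrow> f k \<in> S" "\<And>c. \<exists>k<d. c k \<noteq> 0 \<Longrightarrow>
       Re (ip (\<Sum>k<d. scaleC (c k) (f k)) (\<Sum>k<d. scaleC (c k) (f k))) < 0" by blast
    then show "\<exists>f. (\<forall>k<d. f k \<in> T) \<and> (\<forall>c. (\<exists>k<d. c k \<noteq> 0) \<longrightarrow>
       Re (ip' (\<Sum>k<d. scaleC (c k) (f k)) (\<Sum>k<d. scaleC (c k) (f k))) < 0)"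
      using bij by (intro exI[of _ "\<lambda>k. U (f k)"]) (auto simp: form[OF f(1)] bij_betw_def)
  next
    assume "\<exists>f. (\<forall>k<d. f k \<in> T) \<and> (\<forall>c. (\<exists>k<d. c k \<noteq> 0) \<longrightarrow>
       Re (ip' (\<Sum>k<d. scaleC (c k) (f k)) (\<Sum>k<d. scaleC (c k) (f k))) < 0)"
    then obtain f where f: "\<And>k. k < d \<Longrightarrow> f k \<in> T" "\<And>c. \<exists>k<d. c k \<noteq> 0 \<Longrightarrow>
       Re (ip' (\<Sum>k<d. scaleC (c k) (f k)) (\<Sum>k<d. scaleC (c k) (f k))) < 0" by blast
    define g where "g k = inv_into S U (f k)" for k
    have g: "g k \<in> S" "U (g k) = f k" if "k < d" for k
      using f(1)[OF that] bij by (auto simp: g_def bij_betw_def inv_into_into f_inv_into_f)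
    have "(\<Sum>k<d. scaleC (c k) (f k)) = (\<Sum>k<d. scaleC (c k) (U (g k)))" for c
      using g(2) by simp
    then show "\<exists>f. (\<forall>k<d. f k \<in> S) \<and> (\<forall>c. (\<exists>k<d. c k \<noteq> 0) \<longrightarrow>
       Re (ip (\<Sum>k<d. scaleC (c k) (f k)) (\<Sum>k<d. scaleC (c k) (f k))) < 0)"
      using f(2) g(1) form[OF g(1)] by (intro exI[of _ g]) auto
  qed
qed

text \<open>Each argument is extended from \<open>B\<close> to its span separately, the other being
  held fixed.\<close>

lemma span_isometric:
  assumes "hermitian ip" "hermitian ip'"
    and gen: "\<And>v w. v \<in> B \<Longrightarrow> w \<in> B \<Longrightarrow> ip (fst v) (fst w) = ip' (snd v) (snd w)"
    and "v \<in> cv.span B" "w \<in> cv.span B"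
  shows "ip (fst v) (fst w) = ip' (snd v) (snd w)"
proof -
  interpret a: hermitian ip by fact
  interpret b: hermitian ip' by fact
  have "cv.subspace {v. ip (fst v) (fst w) = ip' (snd v) (snd w)}" for w
    by (intro cv.subspaceI) (auto simp: scaleC_prod_def a.ip_simps b.ip_simps)
  then have 1: "ip (fst v) (fst w) = ip' (snd v) (snd w)" if "v \<in> cv.span B" "w \<in> B" for v w
    using cv.span_minimal[of B "{v. ip (fst v) (fst w) = ip' (snd v) (snd w)}"] gen that by blast
  have "cv.subspace {w. ip (fst v) (fst w) = ip' (snd v) (snd w)}"
    by (intro cv.subspaceI) (auto simp: scaleC_prod_def a.ip_simps b.ip_simps)
  then show ?thesis
    using cv.span_minimal[of B "{w. ip (fst v) (fst w) = ip' (snd v) (snd w)}"] 1 assms(4,5) by blast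
qed

lemma subspace_fst_image:
  fixes W :: "('a::cvec \<times> 'b::cvec) set"
  assumes W: "cv.subspace W" shows "cv.subspace (fst ` W)"
proof (rule cv.subspaceI)
  show "0 \<in> fst ` W" using cv.subspace_0[OF W] by force
  show "x + y \<in> fst ` W" if "x \<in> fst ` W" "y \<in> fst ` W" for x y
    using that cv.subspace_add[OF W] by (auto simp: image_iff) (metis fst_conv plus_prod_def add_Pair)
  show "scaleC c x \<in> fst ` W" if "x \<in> fst ` W" for c x
    using that cv.subspace_scale[OF W] by (auto simp: image_iff) (metis fst_conv scaleC_prod_def)
qed

lemma subspace_snd_image:
  fixes W :: "('a::cvec \<times> 'b::cvec) set"
  assumes W: "cv.subspace W" shows "cv.subspace (snd ` W)"
proof (rule cv.subspaceI)
  show "0 \<in> snd ` W" using cv.subspace_0[OF W] by force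
  show "x + y \<in> snd ` W" if "x \<in> snd ` W" "y \<in> snd ` W" for x y
    using that cv.subspace_add[OF W] by (auto simp: image_iff) (metis snd_conv plus_prod_def add_Pair)
  show "scaleC c x \<in> snd ` W" if "x \<in> snd ` W" for c x
    using that cv.subspace_scale[OF W] by (auto simp: image_iff) (metis snd_conv scaleC_prod_def)
qed

section \<open>Comparison of the orthogonal sum with the minimal representation\<close>

lemma represented_intro:
  assumes "hilbert hip" "adm_decomp ip P N" "represents hip ip A \<Gamma> z0 Q D"
    and "nevanlinna hip \<kappa> Q D"
  shows "represented ip P N hip A \<Gamma> z0 Q D"
  using assms
  by unfold_locales (auto simp: hilbert_def represents_def pontryagin_def nevanlinna_def)

lemma represents_decomp:
  assumes "minimally_represents hip ip A \<Gamma> z0 Q D"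
  obtains P N where "adm_decomp ip P N"
  using assms by (auto simp: minimally_represents_def represents_def pontryagin_def)

theorem theorem6:
  fixes hip :: "'h::cvec \<Rightarrow> 'h \<Rightarrow> complex"
    and ip1 :: "'k1::cvec \<Rightarrow> 'k1 \<Rightarrow> complex" and A1 :: "('k1 \<times> 'k1) set" and \<Gamma>1 :: "'h \<Rightarrow> 'k1"
    and ip2 :: "'k2::cvec \<Rightarrow> 'k2 \<Rightarrow> complex" and A2 :: "('k2 \<times> 'k2) set" and \<Gamma>2 :: "'h \<Rightarrow> 'k2"
    and Q1 Q2 :: "complex \<Rightarrow> 'h \<Rightarrow> 'h" and D1 D2 :: "complex set"
    and z0 :: complex and \<kappa>1 \<kappa>2 \<kappa> :: nat
    and ip :: "'k::cvec \<Rightarrow> 'k \<Rightarrow> complex" and A :: "('k \<times> 'k) set" and \<Gamma> :: "'h \<Rightarrow> 'k"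
    and w0 :: complex
    and L1 L2 F :: "('k1 \<times> 'k2) set"
  defines "Q \<equiv> (\<lambda>z h. Q1 z h + Q2 z h)"
       and "ipt \<equiv> sum_ip ip1 ip2"
    and "L0 \<equiv> pclosure (sum_ip ip1 ip2) (sum_L A1 \<Gamma>1 A2 \<Gamma>2 z0 (D1 \<inter> D2)) \<inter> orth (sum_ip ip1 ip2) (sum_L A1 \<Gamma>1 A2 \<Gamma>2 z0 (D1 \<inter> D2))"
  assumes H: "hilbert hip"
    and N1: "nevanlinna hip \<kappa>1 Q1 D1" and N2: "nevanlinna hip \<kappa>2 Q2 D2"
    and R1: "minimally_represents hip ip1 A1 \<Gamma>1 z0 Q1 D1"
    and R2: "minimally_represents hip ip2 A2 \<Gamma>2 z0 Q2 D2"
    and N: "nevanlinna hip \<kappa> Q (D1 \<inter> D2)"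
    and K: "minimally_represents hip ip A \<Gamma> w0 Q (D1 \<inter> D2)"
    and L1: "csubspace L1" "pclosed ipt L1" "nondegenerate ipt L1"
    and L2: "csubspace L2" "pclosed ipt L2" "nondegenerate ipt L2"
    and F: "csubspace F" "pclosed ipt F" "neutral ipt F" "skewly_linked ipt L0 F"
    and dec_closure: "orth_dsum ipt L1 L0 (pclosure ipt (sum_L A1 \<Gamma>1 A2 \<Gamma>2 z0 (D1 \<inter> D2)))"
    and dec_orth: "orth_dsum ipt L0 L2 (orth ipt (sum_L A1 \<Gamma>1 A2 \<Gamma>2 z0 (D1 \<inter> D2)))"
    and dec_direct: "L0 \<inter> F = {0}"
    and dec_inner: "orth_dsum ipt L1 (ssum L0 F) (ssum L1 (ssum L0 F))"
    and dec_all: "orth_dsum ipt (ssum L1 (ssum L0 F)) L2 UNIV"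
  shows "unit_equiv ipt L1 ip UNIV \<and> has_neg_index ipt L1 \<kappa>"
proof -
  define D where "D = D1 \<inter> D2"
  define Lt where "Lt = sum_L A1 \<Gamma>1 A2 \<Gamma>2 z0 D"
  obtain P1 M1 P2 M2 P M where dec: "adm_decomp ip1 P1 M1" "adm_decomp ip2 P2 M2" "adm_decomp ip P M"
    using represents_decomp[OF R1] represents_decomp[OF R2] represents_decomp[OF K] by metis
  interpret r1: represented ip1 P1 M1 hip A1 \<Gamma>1 z0 Q1 D1
    using R1 by (intro represented_intro[OF H dec(1) _ N1]) (simp add: minimally_represents_def)
  interpret r2: represented ip2 P2 M2 hip A2 \<Gamma>2 z0 Q2 D2
    using R2 by (intro represented_intro[OF H dec(2) _ N2]) (simp add: minimally_represents_def)
  interpret r: represented ip P M hip A \<Gamma> w0 Q D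
    using K N unfolding D_def by (intro represented_intro[OF H dec(3)]) (simp_all add: minimally_represents_def)
  interpret T: pontryagin_decomp ipt "P1 \<times> P2" "M1 \<times> M2"
    unfolding ipt_def by (rule sum_ip_adm_decomp) unfold_locales
  have minimal: "pclosure ip (cspan {r.G z h | z h. z \<in> D}) = UNIV"
    using K by (simp add: minimally_represents_def D_def)
  have D: "open D" "D \<subseteq> {z. Im z \<noteq> 0}"
    and ker: "kernel_neg_squares hip Q D \<kappa>"
    using N by (auto simp: nevanlinna_def D_def)
  define B where "B = {((r1.G z h, r2.G z h), r.G z h) | z h. z \<in> generic D}"
  define W where "W = cv.span B"
  have W_sub: "cv.subspace W" by (simp add: W_def)
  \<comment> \<open>\<open>gram\<close> applies to all three representations at the same two points,
    and the difference quotient of \<open>Q\<close> is the sum of those of \<open>Q1\<close> and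
    \<open>Q2\<close>.\<close>
  have gen: "ipt (fst v) (fst w) = ip (snd v) (snd w)" if vw: "v \<in> B" "w \<in> B" for v w
  proof -
    obtain z h y g where v: "v = ((r1.G z h, r2.G z h), r.G z h)" "z \<in> generic D"
      and w: "w = ((r1.G y g, r2.G y g), r.G y g)" "y \<in> generic D"
      using vw unfolding B_def by blast
    have "z \<in> D" "y \<in> D" "z \<noteq> cnj y" using v w generic_sub generic_neq_cnj by blast+
    then show ?thesis
      by (simp add: v w ipt_def sum_ip_def r1.gram r2.gram r.gram D_def)
        (simp add: nker_def Q_def r1.H.ip_simps add_divide_distrib[symmetric])
  qed
  have Lt: "Lt = cv.span {(r1.G z h, r2.G z h) | z h. z \<in> D}"
    by (simp add: Lt_def sum_L_def cspan_eq_span)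
  have fst_W: "fst ` W \<subseteq> Lt"
  proof -
    have "cv.subspace {v :: ('k1 \<times> 'k2) \<times> 'k. fst v \<in> Lt}"
    proof (rule cv.subspaceI)
      show "scaleC c v \<in> {v. fst v \<in> Lt}" if "v \<in> {v. fst v \<in> Lt}" for c and v :: "('k1 \<times> 'k2) \<times> 'k"
        using that unfolding Lt scaleC_prod_def[of c v] by (simp add: cv.span_scale)
    qed (auto simp: Lt cv.span_zero cv.span_add)
    moreover have "B \<subseteq> {v. fst v \<in> Lt}"
      using generic_sub[of D] unfolding Lt B_def by (fastforce intro: cv.span_base)
    ultimately show ?thesis unfolding W_def using cv.span_minimal by blast
  qed
  have Lt_dense: "Lt \<subseteq> T.ncl (fst ` W)"
    unfolding Lt
  proof (intro cv.span_minimal T.ncl_subspace subspace_fst_image W_sub subsetI)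
    fix x assume "x \<in> {(r1.G z h, r2.G z h) | z h. z \<in> D}"
    then obtain z h where z: "z \<in> D" and x: "x = (r1.G z h, r2.G z h)" by blast
    show "x \<in> T.ncl (fst ` W)" unfolding T.ncl_def
    proof (intro CollectI allI impI)
      fix e :: real assume "e > 0"
      then have e: "e / 2 > 0" by simp
      obtain s where s: "s > 0" "\<forall>y\<in>D1. cmod (z - y) < s \<longrightarrow> r1.nrm (r1.G z h - r1.G y h) < e / 2"
        using r1.G_cont[OF _ e] z unfolding D_def by blast
      obtain t where t: "t > 0" "\<forall>y\<in>D2. cmod (z - y) < t \<longrightarrow> r2.nrm (r2.G z h - r2.G y h) < e / 2"
        using r2.G_cont[OF _ e] z unfolding D_def by blast
      \<comment> \<open>One point \<open>y\<close> has to serve both components, hence the smaller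
        of the two radii.\<close>
      have "min s t > 0" using s t by simp
      then obtain y where y: "y \<in> generic D" "cmod (z - y) < min s t" by (rule generic_dense[OF D z])
      then have yD: "y \<in> D1" "y \<in> D2" using generic_sub D_def by blast+
      have "(r1.G y h, r2.G y h) \<in> fst ` W"
        using y(1) unfolding W_def B_def by (force intro: cv.span_base)
      moreover have "T.nrm (x - (r1.G y h, r2.G y h)) < e"
      proof -
        have "T.nrm (x - (r1.G y h, r2.G y h)) \<le> r1.nrm (r1.G z h - r1.G y h) + r2.nrm (r2.G z h - r2.G y h)"
          using sum_ip_nrm_le[OF r1.pontryagin_decomp_axioms r2.pontryagin_decomp_axioms,
              of "x - (r1.G y h, r2.G y h)"] by (simp add: x ipt_def)
        also have "\<dots> < e / 2 + e / 2" using s t y(2) yD by (intro add_strict_mono) auto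
        finally show ?thesis by simp
      qed
      ultimately show "\<exists>s\<in>fst ` W. T.nrm (x - s) < e" by blast
    qed
  qed
  have zeros: "0 \<in> L0" "0 \<in> F" "0 \<in> L2" "0 \<in> L1"
    using dec_direct L1(1) L2(1) F(1) by (auto simp: csubspace_def)
  have closure_eq: "pclosure ipt Lt = ssum L1 L0"
    using dec_closure by (simp add: orth_dsum_def Lt_def D_def)
  \<comment> \<open>\<open>L0\<close>, \<open>F\<close> and \<open>L2\<close> together form a
    complement orthogonal to \<open>L1\<close>; including \<open>F\<close> makes the sum the whole
    space.\<close>
  interpret iso: isometric_relation ipt "P1 \<times> P2" "M1 \<times> M2" ip P M W L1 "ssum (ssum L0 F) L2"
  proof unfold_locales
    show "cv.subspace W" by (rule W_sub)
    show "ipt (fst v) (fst w) = ip (snd v) (snd w)" if "v \<in> W" "w \<in> W" for v w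
    proof (rule span_isometric[where B = B])
      show "ipt (fst v) (fst w) = ip (snd v) (snd w)" if "v \<in> B" "w \<in> B" for v w
        using that by (rule gen)
    qed (use that T.hermitian_axioms r.hermitian_axioms in \<open>simp_all add: W_def\<close>)
    have "{r.G z h | z h. z \<in> generic D} = snd ` B" unfolding B_def by force
    also have "\<dots> \<subseteq> snd ` W" unfolding W_def by (intro image_mono cv.span_superset)
    finally have "cv.span {r.G z h | z h. z \<in> generic D} \<subseteq> snd ` W"
      by (intro cv.span_minimal subspace_snd_image W_sub)
    then show "r.ncl (snd ` W) = UNIV"
      using r.generic_span_dense[OF D minimal] r.ncl_mono by blast
    show "cv.subspace L1" using L1(1) by (simp add: csubspace_iff)
    show "\<exists>s\<in>L1. \<exists>r\<in>ssum (ssum L0 F) L2. x = s + r" for x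
    proof -
      have "x \<in> ssum (ssum L1 (ssum L0 F)) L2" using dec_all by (auto simp: orth_dsum_def)
      then obtain y b where y: "y \<in> ssum L1 (ssum L0 F)" "b \<in> L2" "x = y + b"
        unfolding ssum_def[of "ssum L1 (ssum L0 F)"] by blast
      then obtain s a where s: "s \<in> L1" "a \<in> ssum L0 F" "y = s + a"
        unfolding ssum_def[of L1] by blast
      have "a + b \<in> ssum (ssum L0 F) L2"
        using s(2) y(2) unfolding ssum_def[of "ssum L0 F"] by blast
      then show ?thesis using s(1,3) y(3) by (intro bexI[of _ s] bexI[of _ "a + b"]) (auto simp: add.assoc)
    qed
    show "ipt s t = 0" if s: "s \<in> L1" and t: "t \<in> ssum (ssum L0 F) L2" for s t
    proof -
      obtain a b where ab: "a \<in> ssum L0 F" "b \<in> L2" "t = a + b"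
        using t unfolding ssum_def[of "ssum L0 F"] by blast
      have "0 \<in> ssum L0 F" using zeros unfolding ssum_def by force
      then have "s \<in> ssum L1 (ssum L0 F)" using s unfolding ssum_def[of L1] by force
      then have "ipt s b = 0" using dec_all ab(2) by (simp add: orth_dsum_def)
      moreover have "ipt s a = 0" using dec_inner s ab(1) by (simp add: orth_dsum_def)
      ultimately show ?thesis by (simp add: ab(3) T.ip_simps)
    qed
    show "L1 \<subseteq> T.ncl (fst ` W)"
    proof -
      have "L1 \<subseteq> pclosure ipt Lt" unfolding closure_eq ssum_def using zeros by force
      also have "\<dots> \<subseteq> T.ncl Lt" by (rule T.pclosure_ncl)
      also have "\<dots> \<subseteq> T.ncl (T.ncl (fst ` W))" by (rule T.ncl_mono[OF Lt_dense])
      also have "\<dots> \<subseteq> T.ncl (fst ` W)" by (rule T.ncl_idem)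
      finally show ?thesis .
    qed
    fix x assume "x \<in> fst ` W"
    then have "x \<in> ssum L1 L0" using fst_W T.pclosure_base closure_eq by blast
    then obtain s r where sr: "s \<in> L1" "r \<in> L0" "x = s + r" unfolding ssum_def by blast
    have "r \<in> ssum L0 F" using sr(2) zeros unfolding ssum_def by force
    then have "r \<in> ssum (ssum L0 F) L2" using zeros unfolding ssum_def[of "ssum L0 F"] by force
    \<comment> \<open>\<open>L0\<close> is contained in the orthogonal complement of
      \<open>Lt\<close>, and the domain of \<open>W\<close> lies in \<open>Lt\<close>.\<close>
    moreover have "ipt (fst v) r = 0" if "v \<in> W" for v
      using sr(2) fst_W that by (auto simp: L0_def orth_def ipt_def Lt_def D_def)
    ultimately show "\<exists>s\<in>L1. \<exists>r\<in>ssum (ssum L0 F) L2. x = s + r \<and> (\<forall>v\<in>W. ipt (fst v) r = 0)"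
      using sr by blast
  qed
  have "has_neg_index ip UNIV \<kappa>"
    by (rule r.state_space_neg_index[OF D minimal ker])
  then have "has_neg_index ipt L1 \<kappa>"
    using unit_equiv_neg_dim[OF T.hermitian_axioms r.hermitian_axioms iso.S_sub cv.subspace_UNIV iso.unit_equiv]
    by (simp add: has_neg_index_def)
  with iso.unit_equiv show ?thesis by blast
qed

end
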